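(* Let $n\geq 2$ be an integer. Let $\lambda$ be a compactly supported Borel probability measure on $\mathbb{R}^n$. Suppose that $\dim_{l^1}\lambda>n-1$. Then for Lebesgue almost all $\theta\in S^{n-1}$, $P_\theta(\lambda)$ is absolutely continuous with respect to the Lebesgue measure on $H_\theta$ with a continuous density function.
   Context: Fourier transform: for a compactly supported Borel probability measure $\lambda$ on $\mathbb{R}^n$, $\hat\lambda(\xi)=\int_{\mathbb{R}^n}e^{-2\pi i(x,\xi)}\,d\lambda(x)$, where $(\cdot,\cdot)$ is the standard Euclidean inner product. $l^1$-dimension: $$\dim_{l^1}\lambda=\sup\Big\{s>0:\ \sup_{\theta\in[0,1]^n}\sum_{\xi\in\mathbb{Z}^n,\,|\xi|\le R}|\hat\lambda(\xi+\theta)|\ll R^{n-s}\Big\},$$ where $\ll$ means that the left side is at most a constant (independent of $R$) times the right side, for all $R\ge 1$. Linear projection: for $\theta\in S^{n-1}$ let $H_\theta\subset\mathbb{R}^n$ be the $(n-1)$-dimensional linear subspace normal to $\theta$. The map $P_\theta:\mathbb{R}^n\to H_\theta$ sends $y$ to the unique $h_y\in H_\theta$ with $y\in h_y+\theta\mathbb{R}$ (the orthogonal projection onto $H_\theta$). $P_\theta(\lambda)$ denotes the push-forward of $\lambda$ under $P_\theta$. *)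

theory Defs
  imports "HOL-Analysis.Analysis" "HOL-Probability.Probability"
begin

definition support_of :: "'a::topological_space measure \<Rightarrow> 'a set" where
  "support_of M = {x. \<forall>U. open U \<and> x \<in> U \<longrightarrow> emeasure M U > 0}"

definition fourier_transform :: "'a::euclidean_space measure \<Rightarrow> 'a \<Rightarrow> complex" where
  "fourier_transform M \<xi> = (CLINT x|M. exp (- 2 * of_real pi * \<i> * of_real (x \<bullet> \<xi>)))"

definition unit_cube :: "(real ^ 'n) set" where
  "unit_cube = {\<theta>. \<forall>i. \<theta> $ i \<in> {0..1}}"

definition lattice_ball :: "real \<Rightarrow> (real ^ 'n) set" where
  "lattice_ball R = {\<xi>. (\<forall>i. \<xi> $ i \<in> \<int>) \<and> norm \<xi> \<le> R}"

(* For a probability measure every term of the finite sum is at most 1, so the real-valued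
   supremum below is over a bounded nonempty set and carries its usual meaning. The outer
   supremum is taken in the extended nonnegative reals, so that it is 0 for the empty set. *)
definition dim_l1 :: "(real ^ 'n) measure \<Rightarrow> ennreal" where
  "dim_l1 M = Sup (ennreal ` {s. s > 0 \<and>
     (\<exists>C. \<forall>R\<ge>1. (SUP \<theta>\<in>unit_cube. \<Sum>\<xi>\<in>lattice_ball R. cmod (fourier_transform M (\<xi> + \<theta>)))
        \<le> C * R powr (real CARD('n) - s))})"

definition normal_hyperplane :: "'a::euclidean_space \<Rightarrow> 'a set" where
  "normal_hyperplane \<theta> = {x. x \<bullet> \<theta> = 0}"

(* The description is proper (exactly one such h exists) whenever \<theta> is nonzero. *)
definition proj_along :: "'a::euclidean_space \<Rightarrow> 'a \<Rightarrow> 'a" where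
  "proj_along \<theta> y = (THE h. h \<in> normal_hyperplane \<theta> \<and> (\<exists>t. y = h + t *\<^sub>R \<theta>))"

definition pushforward_proj :: "'a::euclidean_space \<Rightarrow> 'a measure \<Rightarrow> 'a measure" where
  "pushforward_proj \<theta> M = distr M (restrict_space borel (normal_hyperplane \<theta>)) (proj_along \<theta>)"

definition orthonormal_basis_of :: "'a::euclidean_space set \<Rightarrow> 'a set \<Rightarrow> bool" where
  "orthonormal_basis_of H B \<longleftrightarrow>
     B \<subseteq> H \<and> pairwise orthogonal B \<and> (\<forall>b\<in>B. norm b = 1) \<and> span B = H"

(* Lebesgue measure on a linear subspace H, as a measure with space H: the product Lebesgue measure
   in the coordinates of an orthonormal basis of H, as lborel is defined from Basis. By orthogonal
   invariance the choice of the basis is immaterial. *)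
definition lborel_subspace :: "'a::euclidean_space set \<Rightarrow> 'a measure" where
  "lborel_subspace H =
     (let B = (SOME B. orthonormal_basis_of H B)
      in distr (\<Pi>\<^sub>M b\<in>B. (lborel :: real measure)) (restrict_space borel H)
           (\<lambda>f. \<Sum>b\<in>B. f b *\<^sub>R b))"

(* Lebesgue (surface) measure on the unit sphere: the image of Lebesgue measure on the punctured
   unit ball under radial projection, times the dimension, i.e.
   \<sigma>(A) = n * vol {r *\<^sub>R x | x \<in> A, 0 < r < 1}. *)
definition sphere_measure :: "'a::euclidean_space measure" where
  "sphere_measure = scale_measure (of_nat DIM('a))
     (distr (restrict_space lborel (ball 0 1 - {0})) (restrict_space borel (sphere 0 1))
        (\<lambda>x. x /\<^sub>R norm x))"

end

theory Submission
  imports Defs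
begin

text \<open>
  Write \<open>g\<close> for the absolute value of the Fourier transform of \<open>M\<close> and \<open>n\<close> for the dimension. On the
  hyperplane orthogonal to \<open>\<theta>\<close>, the Fourier transform of the projection of \<open>M\<close> along \<open>\<theta>\<close> is the restriction
  of the Fourier transform of \<open>M\<close>. By Fourier inversion the projection therefore has a continuous density as
  soon as \<open>g\<close> is integrable over this hyperplane.

  A point \<open>\<eta>\<close> lies on the hyperplane of \<open>\<theta>\<close> for a set of directions \<open>\<theta>\<close> whose density is of order
  \<open>1 / |\<eta>|\<close>. So the average over \<open>\<theta>\<close> of the hyperplane integrals of \<open>g\<close> is comparable to the integral of
  \<open>g \<eta> / |\<eta>|\<close> over the whole space. Near the origin this converges because \<open>g \<le> 1\<close> and \<open>n \<ge> 2\<close>. At infinity,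
  \<open>dim_l1 M > n - 1\<close> says that the lattice sums of \<open>g\<close>, and so its integral over the ball of radius \<open>R\<close>,
  are \<open>O(R powr a)\<close> for some \<open>a < 1\<close>, and this makes the integral against \<open>1 / |\<eta>|\<close> converge
  (\<open>fourier_energy_finite\<close>). Hence almost every hyperplane integral is finite
  (\<open>AE_hyperplane_integral_finite\<close>).

  To stay in the full space and avoid coordinates that vary with the hyperplane, both halves use a fixed
  basis vector \<open>k\<close> with \<open>\<theta> \<bullet> k \<noteq> 0\<close>, which excludes only a null set of directions. The hyperplane
  integral of \<open>g\<close> is replaced by the integral over the whole space of \<open>g\<close> composed with the projection along
  \<open>k\<close> onto the hyperplane, times a Gaussian weight in the direction of \<open>k\<close>. Dually, the projected measure is
  replaced by the measure obtained from \<open>M\<close> by moving every point along \<open>\<theta>\<close> until its \<open>k\<close>-th coordinate is an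
  independent Gaussian variable. The transform of that measure is exactly the weighted function just
  described, so inversion in the full space (\<open>fourier_inversion\<close>) gives it a continuous density, and
  integrating this density over the segments that a slab cuts out of the lines parallel to \<open>\<theta>\<close> gives the density
  of the projection (\<open>projection_continuous_density\<close>).
\<close>

section \<open>Gaussians and their Fourier transforms\<close>

lemma fourier_transform_cis:
  "fourier_transform M \<xi> = (CLINT x|M. cis (- (2 * pi * (x \<bullet> \<xi>))))"
  unfolding fourier_transform_def by (simp add: cis_conv_exp algebra_simps)

lemma measurable_cis [measurable]: "cis \<in> borel_measurable borel"
  by (intro borel_measurable_continuous_onI continuous_on_cis continuous_on_id)

text \<open>Lebesgue measure on a Euclidean space is the product of the one-dimensional ones in the
  standard basis, so integrals of products of one-variable functions factor.\<close>

lemma integral_lborel_prod: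
  fixes f :: "'a::euclidean_space \<Rightarrow> real \<Rightarrow> complex"
  assumes "\<And>b. b \<in> Basis \<Longrightarrow> integrable lborel (f b)"
  shows "integrable lborel (\<lambda>x. \<Prod>b\<in>Basis. f b (x \<bullet> b))" (is ?A)
    and "(\<integral>x. (\<Prod>b\<in>Basis. f b (x \<bullet> b)) \<partial>lborel) = (\<Prod>b\<in>Basis. \<integral>t. f b t \<partial>lborel)" (is ?B)
proof -
  interpret product_sigma_finite "\<lambda>_::'a. lborel :: real measure"
    by standard
  let ?P = "Pi\<^sub>M Basis (\<lambda>_::'a. lborel :: real measure)"
  let ?\<Phi> = "\<lambda>x. \<Sum>b\<in>Basis. x b *\<^sub>R b :: 'a"
  have [measurable]: "f b \<in> borel_measurable borel" if "b \<in> Basis" for b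
    using assms[OF that] borel_measurable_integrable by fastforce
  have meas: "(\<lambda>x. \<Prod>b\<in>Basis. f b (x \<bullet> b)) \<in> borel_measurable borel"
    by measurable
  have \<Phi>: "?\<Phi> \<in> measurable ?P borel"
    by measurable
  have eq: "(\<Prod>b\<in>Basis. f b (?\<Phi> x \<bullet> b)) = (\<Prod>b\<in>Basis. f b (x b))" for x
    by (rule prod.cong) auto
  have "integrable ?P (\<lambda>x. \<Prod>b\<in>Basis. f b (x b))"
    by (rule product_integrable_prod) (use assms in auto)
  then show ?A
    by (subst lborel_eq, subst integrable_distr_eq[OF \<Phi> meas]) (simp only: eq)
  have "(\<integral>x. (\<Prod>b\<in>Basis. f b (x \<bullet> b)) \<partial>lborel) = (\<integral>x. (\<Prod>b\<in>Basis. f b (x b)) \<partial>?P)"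
    by (subst lborel_eq, subst integral_distr[OF \<Phi> meas]) (simp only: eq)
  also have "\<dots> = (\<Prod>b\<in>Basis. \<integral>t. f b t \<partial>lborel)"
    by (rule product_integral_prod) (use assms in auto)
  finally show ?B .
qed

text \<open>This is the characteristic function of the standard normal distribution after the substitution
  \<open>x = sqrt (2 * pi) * \<epsilon> * \<xi>\<close>, which converts it to the normalisation of the Fourier transform with
  \<open>2 * pi\<close> in the exponent.\<close>

lemma has_bochner_integral_gaussian_fourier_real:
  fixes t \<epsilon> :: real
  assumes "\<epsilon> > 0"
  shows "has_bochner_integral lborel (\<lambda>\<xi>. cis (2 * pi * (t * \<xi>)) * exp (- pi * \<epsilon>\<^sup>2 * \<xi>\<^sup>2))
           (complex_of_real (exp (- pi * t\<^sup>2 / \<epsilon>\<^sup>2) / \<epsilon>))"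
proof -
  define c where "c = sqrt (2 * pi) * \<epsilon>"
  define s where "s = sqrt (2 * pi) * t / \<epsilon>"
  have c: "c \<noteq> 0" using assms by (simp add: c_def)
  have sc: "s * c = 2 * pi * t" using assms by (simp add: s_def c_def)
  have csq: "c\<^sup>2 = 2 * pi * \<epsilon>\<^sup>2" by (simp add: c_def power_mult_distrib)
  have ssq: "s\<^sup>2 = 2 * pi * t\<^sup>2 / \<epsilon>\<^sup>2" by (simp add: s_def power_mult_distrib power_divide)
  let ?f = "\<lambda>x. std_normal_density x *\<^sub>R iexp (s * x)"
  have "integrable std_normal_distribution (\<lambda>x. iexp (s * x))"
    by (intro finite_measure.integrable_const_bound[where B=1] prob_space.finite_measure
        prob_space_normal_density) auto
  then have int: "integrable lborel ?f"
    by (subst (asm) integrable_density) auto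
  have "(\<integral>x. ?f x \<partial>lborel) = char std_normal_distribution s"
    unfolding char_def by (subst integral_density) auto
  then have val: "(\<integral>x. ?f x \<partial>lborel) = complex_of_real (exp (- (s\<^sup>2) / 2))"
    by (simp add: char_std_normal_distribution)
  have "has_bochner_integral lborel ?f (exp (- (s\<^sup>2) / 2))"
    using int val by (metis has_bochner_integral_integrable)
  then have "has_bochner_integral lborel (\<lambda>\<xi>. ?f (0 + c * \<xi>)) (complex_of_real (exp (- (s\<^sup>2) / 2)) /\<^sub>R \<bar>c\<bar>)"
    using lborel_has_bochner_integral_real_affine_iff[OF c, of ?f _ 0] by blast
  then have "has_bochner_integral lborel (\<lambda>\<xi>. sqrt (2 * pi) *\<^sub>R ?f (0 + c * \<xi>))
      (sqrt (2 * pi) *\<^sub>R (complex_of_real (exp (- (s\<^sup>2) / 2)) /\<^sub>R \<bar>c\<bar>))"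
    by (rule has_bochner_integral_scaleR_right)
  also have "(\<lambda>\<xi>. sqrt (2 * pi) *\<^sub>R ?f (0 + c * \<xi>)) = (\<lambda>\<xi>. cis (2 * pi * (t * \<xi>)) * exp (- pi * \<epsilon>\<^sup>2 * \<xi>\<^sup>2))"
  proof
    fix \<xi>
    have 1: "s * (c * \<xi>) = 2 * pi * (t * \<xi>)" using sc by (simp add: mult.assoc[symmetric])
    have 2: "std_normal_density (c * \<xi>) = exp (- pi * \<epsilon>\<^sup>2 * \<xi>\<^sup>2) / sqrt (2 * pi)"
      by (simp add: std_normal_density_def power_mult_distrib csq)
    show "sqrt (2 * pi) *\<^sub>R ?f (0 + c * \<xi>) = cis (2 * pi * (t * \<xi>)) * exp (- pi * \<epsilon>\<^sup>2 * \<xi>\<^sup>2)"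
      unfolding add_0 1 2 by (simp add: scaleR_conv_of_real cis_conv_exp)
  qed
  also have "sqrt (2 * pi) *\<^sub>R (complex_of_real (exp (- (s\<^sup>2) / 2)) /\<^sub>R \<bar>c\<bar>)
      = complex_of_real (exp (- pi * t\<^sup>2 / \<epsilon>\<^sup>2) / \<epsilon>)"
    using assms by (simp add: ssq c_def scaleR_conv_of_real abs_mult field_simps)
  finally show ?thesis .
qed

text \<open>The \<open>L\<^sup>1\<close>-normalised dilates of \<open>exp (- pi * |z|\<^sup>2)\<close>, that is, the Fourier transforms of the damping
  factors \<open>exp (- pi * \<epsilon>\<^sup>2 * |\<xi>|\<^sup>2)\<close>. They form an approximate identity as \<open>\<epsilon>\<close> tends to 0.\<close>

definition gauss_kernel :: "real \<Rightarrow> 'a::euclidean_space \<Rightarrow> real" where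
  "gauss_kernel \<epsilon> z = exp (- pi * (norm z)\<^sup>2 / \<epsilon>\<^sup>2) / \<epsilon> ^ DIM('a)"

lemma gauss_kernel_measurable [measurable]: "gauss_kernel \<epsilon> \<in> borel_measurable borel"
  unfolding gauss_kernel_def by measurable

lemma gauss_kernel_nonneg: "\<epsilon> > 0 \<Longrightarrow> 0 \<le> gauss_kernel \<epsilon> z"
  by (simp add: gauss_kernel_def)

lemma has_bochner_integral_gaussian_fourier:
  fixes z :: "'a::euclidean_space"
  assumes "\<epsilon> > 0"
  shows "has_bochner_integral lborel (\<lambda>\<xi>. cis (2 * pi * (z \<bullet> \<xi>)) * exp (- pi * \<epsilon>\<^sup>2 * (norm \<xi>)\<^sup>2))
           (complex_of_real (gauss_kernel \<epsilon> z))"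
proof -
  let ?f = "\<lambda>b \<xi>. cis (2 * pi * ((z \<bullet> b) * \<xi>)) * complex_of_real (exp (- pi * \<epsilon>\<^sup>2 * \<xi>\<^sup>2))"
  have fb: "has_bochner_integral lborel (?f b) (complex_of_real (exp (- pi * (z \<bullet> b)\<^sup>2 / \<epsilon>\<^sup>2) / \<epsilon>))" for b
    by (rule has_bochner_integral_gaussian_fourier_real[OF assms])
  have nrm: "(norm x)\<^sup>2 = (\<Sum>b\<in>Basis. (x \<bullet> b)\<^sup>2)" for x :: 'a
    by (subst power2_norm_eq_inner, subst euclidean_inner) (simp add: power2_eq_square)
  have cis_sum: "cis (\<Sum>b\<in>A. h b) = (\<Prod>b\<in>A. cis (h b))" if "finite A" for A and h :: "'a \<Rightarrow> real"
    using that by (induction rule: finite_induct) (auto simp: cis_mult[symmetric])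
  have eq: "(\<lambda>\<xi>. \<Prod>b\<in>Basis. ?f b (\<xi> \<bullet> b)) = (\<lambda>\<xi>::'a. cis (2 * pi * (z \<bullet> \<xi>)) * exp (- pi * \<epsilon>\<^sup>2 * (norm \<xi>)\<^sup>2))"
  proof
    fix \<xi> :: 'a
    have "(\<Prod>b\<in>Basis. ?f b (\<xi> \<bullet> b)) = cis (\<Sum>b\<in>Basis. 2 * pi * ((z \<bullet> b) * (\<xi> \<bullet> b)))
        * complex_of_real (exp (\<Sum>b\<in>Basis. - pi * \<epsilon>\<^sup>2 * (\<xi> \<bullet> b)\<^sup>2))"
      by (simp add: prod.distrib cis_sum exp_sum)
    also have "(\<Sum>b\<in>Basis. 2 * pi * ((z \<bullet> b) * (\<xi> \<bullet> b))) = 2 * pi * (z \<bullet> \<xi>)"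
      by (subst euclidean_inner) (simp add: sum_distrib_left)
    also have "(\<Sum>b\<in>Basis. - pi * \<epsilon>\<^sup>2 * (\<xi> \<bullet> b)\<^sup>2) = - pi * \<epsilon>\<^sup>2 * (norm \<xi>)\<^sup>2"
      by (simp only: nrm sum_distrib_left)
    finally show "(\<Prod>b\<in>Basis. ?f b (\<xi> \<bullet> b)) = cis (2 * pi * (z \<bullet> \<xi>)) * exp (- pi * \<epsilon>\<^sup>2 * (norm \<xi>)\<^sup>2)" .
  qed
  have val: "(\<Prod>b\<in>Basis. \<integral>t. ?f b t \<partial>lborel) = complex_of_real (gauss_kernel \<epsilon> z)"
  proof -
    have "(\<Prod>b\<in>(Basis::'a set). \<integral>t. ?f b t \<partial>lborel) = (\<Prod>b\<in>(Basis::'a set). complex_of_real (exp (- pi * (z \<bullet> b)\<^sup>2 / \<epsilon>\<^sup>2) / \<epsilon>))"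
      by (rule prod.cong[OF refl]) (rule has_bochner_integral_integral_eq[OF fb])
    also have "\<dots> = complex_of_real ((\<Prod>b\<in>(Basis::'a set). exp (- pi * (z \<bullet> b)\<^sup>2 / \<epsilon>\<^sup>2)) / \<epsilon> ^ DIM('a))"
      by (simp add: prod_dividef)
    also have "(\<Prod>b\<in>(Basis::'a set). exp (- pi * (z \<bullet> b)\<^sup>2 / \<epsilon>\<^sup>2)) = exp (\<Sum>b\<in>Basis. - pi * (z \<bullet> b)\<^sup>2 / \<epsilon>\<^sup>2)"
      by (simp add: exp_sum)
    also have "(\<Sum>b\<in>Basis. - pi * (z \<bullet> b)\<^sup>2 / \<epsilon>\<^sup>2) = - pi * (norm z)\<^sup>2 / \<epsilon>\<^sup>2"
      by (simp only: nrm sum_distrib_left sum_divide_distrib)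
    finally show ?thesis by (simp add: gauss_kernel_def)
  qed
  have "integrable lborel (?f b)" for b
    using fb[of b] by (simp add: has_bochner_integral_iff)
  then have "has_bochner_integral lborel (\<lambda>\<xi>. \<Prod>b\<in>Basis. ?f b (\<xi> \<bullet> b)) (\<Prod>b\<in>Basis. \<integral>t. ?f b t \<partial>lborel)"
    unfolding has_bochner_integral_iff by (intro conjI integral_lborel_prod)
  then show ?thesis
    unfolding eq val .
qed

text \<open>Apply the transform formula with \<open>1 / \<epsilon>\<close> in place of \<open>\<epsilon>\<close> and at the point \<open>0\<close>: it computes the total
  integral of \<open>exp (- pi * |z|\<^sup>2 / \<epsilon>\<^sup>2)\<close>.\<close>

lemma gauss_kernel_prob:
  assumes "\<epsilon> > 0"
  shows "(\<integral>\<^sup>+z. ennreal (gauss_kernel \<epsilon> (z::'a::euclidean_space)) \<partial>lborel) = 1"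
proof -
  have e: "1 / \<epsilon> > 0" using assms by simp
  have "has_bochner_integral lborel (\<lambda>\<xi>::'a. complex_of_real (exp (- pi * (1 / \<epsilon>)\<^sup>2 * (norm \<xi>)\<^sup>2)))
      (complex_of_real (\<epsilon> ^ DIM('a)))"
    using has_bochner_integral_gaussian_fourier[OF e, of "0::'a"]
    by (simp add: gauss_kernel_def power_divide)
  then have "has_bochner_integral lborel (\<lambda>\<xi>::'a. exp (- pi * (1 / \<epsilon>)\<^sup>2 * (norm \<xi>)\<^sup>2)) (\<epsilon> ^ DIM('a))"
    by (simp only: has_bochner_integral_iff complex_of_real_integrable_eq integral_complex_of_real of_real_eq_iff)
  then have "has_bochner_integral lborel (\<lambda>\<xi>::'a. exp (- pi * (1 / \<epsilon>)\<^sup>2 * (norm \<xi>)\<^sup>2) / \<epsilon> ^ DIM('a)) (\<epsilon> ^ DIM('a) / \<epsilon> ^ DIM('a))"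
    by (rule has_bochner_integral_divide_zero)
  then have "has_bochner_integral lborel (gauss_kernel \<epsilon> :: 'a \<Rightarrow> real) 1"
    using assms by (simp add: gauss_kernel_def[abs_def] power_divide)
  then show ?thesis
    using gauss_kernel_nonneg[OF assms]
    by (subst nn_integral_eq_integral) (auto simp: has_bochner_integral_iff)
qed

section \<open>Fourier inversion for measures with integrable transform\<close>

lemma fourier_transform_measurable:
  fixes M :: "'a::euclidean_space measure"
  assumes "finite_measure M" and [measurable_cong]: "sets M = sets borel"
  shows "fourier_transform M \<in> borel_measurable borel"
proof -
  interpret finite_measure M by fact
  show ?thesis
    unfolding fourier_transform_cis[abs_def] by measurable
qed

lemma norm_fourier_transform_le_1:
  assumes "prob_space M"
  shows "cmod (fourier_transform M \<xi>) \<le> 1"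
proof -
  interpret prob_space M by fact
  have "cmod (fourier_transform M \<xi>) \<le> (\<integral>x. norm (cis (- (2 * pi * (x \<bullet> \<xi>)))) \<partial>M)"
    unfolding fourier_transform_cis by (rule integral_norm_bound)
  also have "\<dots> \<le> 1" by (simp add: prob_space)
  finally show ?thesis .
qed

lemma nn_integral_gauss_kernel_translate:
  fixes \<phi> :: "'a::euclidean_space \<Rightarrow> ennreal"
  assumes [measurable]: "\<phi> \<in> borel_measurable borel" and "\<epsilon> > 0"
  shows "(\<integral>\<^sup>+y. \<phi> y * ennreal (gauss_kernel \<epsilon> (y - x)) \<partial>lborel)
       = (\<integral>\<^sup>+z. \<phi> (x + \<epsilon> *\<^sub>R z) * ennreal (gauss_kernel 1 z) \<partial>lborel)"
proof -
  have "(\<integral>\<^sup>+y. \<phi> y * ennreal (gauss_kernel \<epsilon> (y - x)) \<partial>lborel)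
      = (\<integral>\<^sup>+z. ennreal (\<epsilon> ^ DIM('a)) * (\<phi> (x + \<epsilon> *\<^sub>R z) * ennreal (gauss_kernel \<epsilon> (\<epsilon> *\<^sub>R z))) \<partial>lborel)"
    using assms(2)
    by (subst lborel_affine[of \<epsilon> x]) (auto simp: nn_integral_density nn_integral_distr)
  also have "\<dots> = (\<integral>\<^sup>+z. \<phi> (x + \<epsilon> *\<^sub>R z) * ennreal (gauss_kernel 1 z) \<partial>lborel)"
  proof (rule nn_integral_cong)
    fix z :: 'a
    have "\<epsilon> ^ DIM('a) * gauss_kernel \<epsilon> (\<epsilon> *\<^sub>R z) = gauss_kernel 1 z"
      using assms(2) by (simp add: gauss_kernel_def power_mult_distrib)
    then have "ennreal (\<epsilon> ^ DIM('a)) * ennreal (gauss_kernel \<epsilon> (\<epsilon> *\<^sub>R z)) = ennreal (gauss_kernel 1 z)"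
      using assms(2) by (metis ennreal_mult gauss_kernel_nonneg less_imp_le zero_le_power)
    then show "ennreal (\<epsilon> ^ DIM('a)) * (\<phi> (x + \<epsilon> *\<^sub>R z) * ennreal (gauss_kernel \<epsilon> (\<epsilon> *\<^sub>R z)))
        = \<phi> (x + \<epsilon> *\<^sub>R z) * ennreal (gauss_kernel 1 z)"
      by (metis mult.assoc mult.commute)
  qed
  finally show ?thesis .
qed

text \<open>The bumps \<open>min 1 (m * dist (x, -U))\<close> increase to the indicator of a bounded open set \<open>U\<close>, so integrals
  of bumps determine the measure of \<open>U\<close>, in particular of every open box. The bound on \<open>F\<close> and the bounded
  supports provide the dominating functions.\<close>

lemma measure_eq_density_if_test_functions:
  fixes \<nu> :: "'a::euclidean_space measure" and F :: "'a \<Rightarrow> real"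
  assumes "finite_measure \<nu>" and sets_\<nu> [measurable_cong]: "sets \<nu> = sets borel"
    and [measurable]: "F \<in> borel_measurable borel" and F_bound: "\<And>x. F x \<le> C"
    and test: "\<And>\<phi>. continuous_on UNIV \<phi> \<Longrightarrow> (\<And>x. 0 \<le> \<phi> x \<and> \<phi> x \<le> 1) \<Longrightarrow> bounded {x. \<phi> x \<noteq> 0} \<Longrightarrow>
        (\<integral>\<^sup>+x. ennreal (\<phi> x) \<partial>\<nu>) = (\<integral>\<^sup>+x. ennreal (\<phi> x) * ennreal (F x) \<partial>lborel)"
  shows "\<nu> = density lborel (\<lambda>x. ennreal (F x))"
proof -
  interpret finite_measure \<nu> by fact
  have open_eq: "emeasure \<nu> U = emeasure (density lborel (\<lambda>x. ennreal (F x))) U"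
    if U: "open U" "bounded U" for U :: "'a set"
  proof -
    have [measurable]: "U \<in> sets borel" using U by simp
    have ne: "- U \<noteq> {}" using U(2) not_bounded_UNIV by (metis Compl_UNIV_eq double_compl)
    have cl: "closed (- U)" using U(1) by (rule closed_Compl)
    define \<phi> where "\<phi> m x = min 1 (real m * infdist x (- U))" for m x
    have \<phi>01: "0 \<le> \<phi> m x \<and> \<phi> m x \<le> 1" for m x
      by (simp add: \<phi>_def infdist_nonneg)
    have \<phi>c: "continuous_on UNIV (\<phi> m)" for m
      unfolding \<phi>_def by (intro continuous_intros)
    have [measurable]: "\<phi> m \<in> borel_measurable borel" for m
      using \<phi>c by (rule borel_measurable_continuous_onI)
    have \<phi>0: "\<phi> m x = 0" if "x \<notin> U" for m x
      using that by (simp add: \<phi>_def)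
    have \<phi>b: "bounded {x. \<phi> m x \<noteq> 0}" for m
      by (rule bounded_subset[OF U(2)]) (use \<phi>0 in auto)
    have le: "ennreal (\<phi> m x) \<le> indicator U x" for m x
      using \<phi>0[of x m] \<phi>01[of m x] by (auto simp: indicator_def)
    have lim: "(\<lambda>m. ennreal (\<phi> m x)) \<longlonglongrightarrow> indicator U x" for x
    proof (cases "x \<in> U")
      case True
      then have pos: "infdist x (- U) > 0"
        using infdist_pos_not_in_closed[OF cl ne, of x] by simp
      obtain N :: nat where N: "1 / infdist x (- U) < real N" using reals_Archimedean2 by blast
      have "\<phi> m x = 1" if "m \<ge> N" for m
      proof -
        have "1 < real N * infdist x (- U)" using N pos by (simp add: field_simps)
        also have "\<dots> \<le> real m * infdist x (- U)" using that pos by simp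
        finally show ?thesis by (simp add: \<phi>_def)
      qed
      then have "eventually (\<lambda>m. ennreal (\<phi> m x) = indicator U x) sequentially"
        using True by (auto simp: eventually_sequentially)
      then show ?thesis by (rule tendsto_eventually)
    qed (simp add: \<phi>0)
    have fin: "emeasure lborel U < \<infinity>"
      using U(2) by (rule emeasure_bounded_finite)
    have 1: "(\<lambda>m. \<integral>\<^sup>+x. ennreal (\<phi> m x) \<partial>\<nu>) \<longlonglongrightarrow> (\<integral>\<^sup>+x. indicator U x \<partial>\<nu>)"
      by (rule nn_integral_dominated_convergence[where w="indicator U"])
         (use le lim in \<open>auto simp: less_top[symmetric]\<close>)
    have 2: "(\<lambda>m. \<integral>\<^sup>+x. ennreal (\<phi> m x) * ennreal (F x) \<partial>lborel) \<longlonglongrightarrow> (\<integral>\<^sup>+x. indicator U x * ennreal (F x) \<partial>lborel)"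
    proof (rule nn_integral_dominated_convergence[where w="\<lambda>x. ennreal C * indicator U x"])
      show "AE x in lborel. ennreal (\<phi> m x) * ennreal (F x) \<le> ennreal C * indicator U x" for m
        using le[of m] F_bound by (auto simp: mult.commute[of "ennreal C"] intro!: mult_mono ennreal_leI)
      show "(\<integral>\<^sup>+x. ennreal C * indicator U x \<partial>lborel) < \<infinity>"
        using fin by (simp add: nn_integral_cmult ennreal_mult_less_top)
      show "AE x in lborel. (\<lambda>m. ennreal (\<phi> m x) * ennreal (F x)) \<longlonglongrightarrow> indicator U x * ennreal (F x)"
        using lim by (intro AE_I2 tendsto_mult_ennreal) (auto simp: indicator_def)
    qed auto
    have "(\<integral>\<^sup>+x. indicator U x \<partial>\<nu>) = (\<integral>\<^sup>+x. indicator U x * ennreal (F x) \<partial>lborel)"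
      using 1 2 test[OF \<phi>c \<phi>01 \<phi>b] LIMSEQ_unique by auto
    then show ?thesis
      by (simp add: emeasure_density mult.commute)
  qed
  show ?thesis
  proof (rule measure_eqI_generator_eq[where E="range (\<lambda>(a, b). box a b)" and \<Omega>=UNIV
        and A="\<lambda>i. box (- (real i *\<^sub>R One)) (real i *\<^sub>R One)"])
    show "Int_stable (range (\<lambda>(a, b). box a b :: 'a set))"
      by (auto simp: Int_stable_def box_Int_box)
    show "sets \<nu> = sigma_sets UNIV (range (\<lambda>(a, b). box a b))"
      by (simp add: sets_\<nu> borel_eq_box)
    show "sets (density lborel (\<lambda>x. ennreal (F x))) = sigma_sets UNIV (range (\<lambda>(a, b). box a b))"
      by (simp add: borel_eq_box)
    show "(\<Union>i. box (- (real i *\<^sub>R One)) (real i *\<^sub>R One) :: 'a set) = UNIV"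
      by (rule UN_box_eq_UNIV)
  qed (auto simp: open_eq[OF open_box bounded_box, symmetric])
qed

text \<open>Smear \<open>\<nu>\<close> with the Gaussian kernel. The smeared measure has the density \<open>p \<epsilon>\<close>, and by Fubini \<open>p \<epsilon>\<close> is the
  inverse Fourier integral of the transform of \<open>\<nu>\<close> damped by \<open>exp (- pi * \<epsilon>\<^sup>2 * |\<xi>|\<^sup>2)\<close>. As \<open>\<epsilon>\<close> tends to 0,
  integrability of the transform lets the damping factor be dropped under the integral, so \<open>p \<epsilon>\<close> converges
  boundedly to the undamped inverse integral \<open>F\<close>; positivity passes to the limit. On the other hand the
  smeared measures converge weakly to \<open>\<nu>\<close>, so \<open>\<nu>\<close> and \<open>F\<close> integrate bumps in the same way.\<close>

lemma fourier_inversion: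
  fixes \<nu> :: "'a::euclidean_space measure"
  assumes "prob_space \<nu>" and sets_\<nu> [measurable_cong]: "sets \<nu> = sets borel"
    and int: "integrable lborel (fourier_transform \<nu>)"
  obtains F :: "'a \<Rightarrow> real" where "continuous_on UNIV F" "\<And>x. 0 \<le> F x"
    "\<nu> = density lborel (\<lambda>x. ennreal (F x))"
proof -
  interpret prob_space \<nu> by fact
  have ft [measurable]: "fourier_transform \<nu> \<in> borel_measurable borel"
    using int by auto
  define \<Psi> where "\<Psi> y = (\<integral>\<xi>. fourier_transform \<nu> \<xi> * cis (2 * pi * (y \<bullet> \<xi>)) \<partial>lborel)" for y
  define C where "C = (\<integral>\<xi>. cmod (fourier_transform \<nu> \<xi>) \<partial>lborel)"
  define F where "F y = Re (\<Psi> y)" for y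
  define p where "p \<epsilon> y = (\<integral>x. gauss_kernel \<epsilon> (y - x) \<partial>\<nu>)" for \<epsilon> y
  have intC: "integrable lborel (\<lambda>\<xi>. cmod (fourier_transform \<nu> \<xi>))"
    using int by simp
  have p_eq: "complex_of_real (p \<epsilon> y) = (\<integral>\<xi>. fourier_transform \<nu> \<xi> * cis (2 * pi * (y \<bullet> \<xi>))
      * exp (- pi * \<epsilon>\<^sup>2 * (norm \<xi>)\<^sup>2) \<partial>lborel)" if "\<epsilon> > 0" for \<epsilon> y
  proof -
    interpret pair_sigma_finite \<nu> lborel ..
    let ?g = "\<lambda>(x, \<xi>). cis (2 * pi * ((y - x) \<bullet> \<xi>)) * complex_of_real (exp (- pi * \<epsilon>\<^sup>2 * (norm \<xi>)\<^sup>2))"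
    have gi: "integrable (\<nu> \<Otimes>\<^sub>M lborel) ?g"
    proof (rule Fubini_integrable)
      show "integrable \<nu> (\<lambda>x. \<integral>\<xi>. norm (?g (x, \<xi>)) \<partial>lborel)"
        by (simp add: norm_mult)
      show "AE x in \<nu>. integrable lborel (\<lambda>\<xi>. ?g (x, \<xi>))"
        using has_bochner_integral_gaussian_fourier[OF that] by (auto simp: has_bochner_integral_iff)
    qed measurable
    have "complex_of_real (p \<epsilon> y) = (\<integral>x. complex_of_real (gauss_kernel \<epsilon> (y - x)) \<partial>\<nu>)"
      by (simp add: p_def)
    also have "\<dots> = (\<integral>x. (\<integral>\<xi>. ?g (x, \<xi>) \<partial>lborel) \<partial>\<nu>)"
      by (simp only: prod.case has_bochner_integral_integral_eq[OF has_bochner_integral_gaussian_fourier[OF that]])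
    also have "\<dots> = (\<integral>\<xi>. (\<integral>x. ?g (x, \<xi>) \<partial>\<nu>) \<partial>lborel)"
      using Fubini_integral[OF gi] by simp
    also have "\<dots> = (\<integral>\<xi>. fourier_transform \<nu> \<xi> * cis (2 * pi * (y \<bullet> \<xi>)) * exp (- pi * \<epsilon>\<^sup>2 * (norm \<xi>)\<^sup>2) \<partial>lborel)"
    proof (rule Bochner_Integration.integral_cong[OF refl])
      fix \<xi>
      have "cis (2 * pi * ((y - x) \<bullet> \<xi>)) = cis (- (2 * pi * (x \<bullet> \<xi>))) * cis (2 * pi * (y \<bullet> \<xi>))" for x
        by (simp add: cis_mult inner_diff_left algebra_simps)
      then have "(\<integral>x. ?g (x, \<xi>) \<partial>\<nu>) = (\<integral>x. cis (- (2 * pi * (x \<bullet> \<xi>))) * (cis (2 * pi * (y \<bullet> \<xi>)) * exp (- pi * \<epsilon>\<^sup>2 * (norm \<xi>)\<^sup>2)) \<partial>\<nu>)"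
        by (simp add: mult.assoc)
      also have "\<dots> = fourier_transform \<nu> \<xi> * (cis (2 * pi * (y \<bullet> \<xi>)) * exp (- pi * \<epsilon>\<^sup>2 * (norm \<xi>)\<^sup>2))"
        unfolding fourier_transform_cis by (rule integral_mult_left_zero)
      finally show "(\<integral>x. ?g (x, \<xi>) \<partial>\<nu>) = fourier_transform \<nu> \<xi> * cis (2 * pi * (y \<bullet> \<xi>)) * exp (- pi * \<epsilon>\<^sup>2 * (norm \<xi>)\<^sup>2)"
        by (simp add: mult.assoc)
    qed
    finally show ?thesis .
  qed
  have p_nonneg: "0 \<le> p \<epsilon> y" if "\<epsilon> > 0" for \<epsilon> y
    unfolding p_def using gauss_kernel_nonneg[OF that] by (intro integral_nonneg_AE AE_I2)
  have p_le: "p \<epsilon> y \<le> C" if "\<epsilon> > 0" for \<epsilon> y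
  proof -
    have "p \<epsilon> y = cmod (p \<epsilon> y)" using p_nonneg[OF that] by simp
    also have "\<dots> \<le> (\<integral>\<xi>. cmod (fourier_transform \<nu> \<xi> * cis (2 * pi * (y \<bullet> \<xi>)) * exp (- pi * \<epsilon>\<^sup>2 * (norm \<xi>)\<^sup>2)) \<partial>lborel)"
      unfolding p_eq[OF that] by (rule integral_norm_bound)
    also have "\<dots> \<le> C"
      unfolding C_def
      by (rule integral_mono_AE'[OF intC]) (auto simp: norm_mult intro!: mult_left_le)
    finally show ?thesis .
  qed
  define \<delta> where "\<delta> m = 1 / real (Suc m)" for m
  have \<delta>: "\<delta> m > 0" for m by (simp add: \<delta>_def)
  have \<delta>0: "\<delta> \<longlonglongrightarrow> 0" unfolding \<delta>_def by (rule lim_1_over_n[THEN LIMSEQ_Suc])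
  have p_lim: "(\<lambda>m. complex_of_real (p (\<delta> m) y)) \<longlonglongrightarrow> \<Psi> y" for y
    unfolding p_eq[OF \<delta>] \<Psi>_def
  proof (rule integral_dominated_convergence[OF _ _ intC])
    show "AE \<xi> in lborel. (\<lambda>m. fourier_transform \<nu> \<xi> * cis (2 * pi * (y \<bullet> \<xi>)) * complex_of_real (exp (- pi * (\<delta> m)\<^sup>2 * (norm \<xi>)\<^sup>2)))
          \<longlonglongrightarrow> fourier_transform \<nu> \<xi> * cis (2 * pi * (y \<bullet> \<xi>))"
    proof (rule AE_I2)
      fix \<xi> :: 'a
      have "(\<lambda>m. exp (- pi * (\<delta> m)\<^sup>2 * (norm \<xi>)\<^sup>2)) \<longlonglongrightarrow> exp (- pi * 0\<^sup>2 * (norm \<xi>)\<^sup>2)"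
        by (intro tendsto_intros \<delta>0)
      then have "(\<lambda>m. complex_of_real (exp (- pi * (\<delta> m)\<^sup>2 * (norm \<xi>)\<^sup>2))) \<longlonglongrightarrow> complex_of_real 1"
        by (intro tendsto_of_real) simp
      from tendsto_mult_left[OF this, of "fourier_transform \<nu> \<xi> * cis (2 * pi * (y \<bullet> \<xi>))"]
      show "(\<lambda>m. fourier_transform \<nu> \<xi> * cis (2 * pi * (y \<bullet> \<xi>)) * complex_of_real (exp (- pi * (\<delta> m)\<^sup>2 * (norm \<xi>)\<^sup>2)))
          \<longlonglongrightarrow> fourier_transform \<nu> \<xi> * cis (2 * pi * (y \<bullet> \<xi>))" by simp
    qed
  qed (auto simp: norm_mult intro!: mult_left_le)
  have pF: "(\<lambda>m. p (\<delta> m) y) \<longlonglongrightarrow> F y" for y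
    using tendsto_Re[OF p_lim[of y]] by (simp add: F_def)
  have F_nonneg: "0 \<le> F y" for y
    by (rule LIMSEQ_le_const[OF pF]) (use p_nonneg[OF \<delta>] in auto)
  have F_le: "F y \<le> C" for y
    by (rule LIMSEQ_le_const2[OF pF]) (use p_le[OF \<delta>] in auto)
  have "isCont \<Psi> y" for y
    unfolding continuous_at_sequentially comp_def \<Psi>_def
  proof (intro allI impI integral_dominated_convergence[OF _ _ intC])
    fix u assume u: "u \<longlonglongrightarrow> y"
    show "AE \<xi> in lborel. (\<lambda>m. fourier_transform \<nu> \<xi> * cis (2 * pi * (u m \<bullet> \<xi>))) \<longlonglongrightarrow> fourier_transform \<nu> \<xi> * cis (2 * pi * (y \<bullet> \<xi>))"
      using u by (intro AE_I2 tendsto_intros)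
  qed (auto simp: norm_mult)
  then have F_cont: "continuous_on UNIV F"
    unfolding F_def by (intro continuous_intros continuous_at_imp_continuous_on) auto
  then have [measurable]: "F \<in> borel_measurable borel"
    by (rule borel_measurable_continuous_onI)
  have "\<nu> = density lborel (\<lambda>x. ennreal (F x))"
  proof (rule measure_eq_density_if_test_functions[OF finite_measure_axioms sets_\<nu> _ F_le])
    fix \<phi> :: "'a \<Rightarrow> real"
    assume \<phi>: "continuous_on UNIV \<phi>" "\<And>x. 0 \<le> \<phi> x \<and> \<phi> x \<le> 1" "bounded {x. \<phi> x \<noteq> 0}"
    have [measurable]: "\<phi> \<in> borel_measurable borel"
      using \<phi>(1) by (rule borel_measurable_continuous_onI)
    let ?S = "closure {x. \<phi> x \<noteq> 0}"
    have fin: "emeasure lborel ?S < \<infinity>"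
      using \<phi>(3) by (intro emeasure_bounded_finite bounded_closure)
    have [measurable]: "?S \<in> sets borel" by simp
    have pm [measurable]: "p \<epsilon> \<in> borel_measurable borel" for \<epsilon>
      unfolding p_def[abs_def] by measurable
    \<comment> \<open>Rescaling the Gaussian variable turns integration against the smeared measure into an average of \<open>\<phi> (x + \<epsilon> z)\<close>, where the limit is visible.\<close>
    have swap: "(\<integral>\<^sup>+y. ennreal (\<phi> y) * ennreal (p \<epsilon> y) \<partial>lborel)
        = (\<integral>\<^sup>+(x, z). ennreal (\<phi> (x + \<epsilon> *\<^sub>R z)) * ennreal (gauss_kernel 1 z) \<partial>(\<nu> \<Otimes>\<^sub>M lborel))" if "\<epsilon> > 0" for \<epsilon>
    proof -
      interpret pair_sigma_finite \<nu> lborel ..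
      have "gauss_kernel \<epsilon> (y - x) \<le> 1 / \<epsilon> ^ DIM('a)" for x y :: 'a
        using that by (auto simp: gauss_kernel_def divide_right_mono)
      then have "integrable \<nu> (\<lambda>x. gauss_kernel \<epsilon> (y - x))" for y
        by (intro integrable_const_bound[where B="1 / \<epsilon> ^ DIM('a)"])
           (auto simp: abs_of_nonneg[OF gauss_kernel_nonneg[OF that]])
      then have "ennreal (p \<epsilon> y) = (\<integral>\<^sup>+x. ennreal (gauss_kernel \<epsilon> (y - x)) \<partial>\<nu>)" for y
        unfolding p_def using gauss_kernel_nonneg[OF that] by (subst nn_integral_eq_integral) auto
      then have "(\<integral>\<^sup>+y. ennreal (\<phi> y) * ennreal (p \<epsilon> y) \<partial>lborel)
          = (\<integral>\<^sup>+y. (\<integral>\<^sup>+x. ennreal (\<phi> y) * ennreal (gauss_kernel \<epsilon> (y - x)) \<partial>\<nu>) \<partial>lborel)"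
        by (simp add: nn_integral_cmult)
      also have "\<dots> = (\<integral>\<^sup>+x. (\<integral>\<^sup>+y. ennreal (\<phi> y) * ennreal (gauss_kernel \<epsilon> (y - x)) \<partial>lborel) \<partial>\<nu>)"
        by (rule Fubini') measurable
      also have "\<dots> = (\<integral>\<^sup>+x. (\<integral>\<^sup>+z. ennreal (\<phi> (x + \<epsilon> *\<^sub>R z)) * ennreal (gauss_kernel 1 z) \<partial>lborel) \<partial>\<nu>)"
        by (intro nn_integral_cong nn_integral_gauss_kernel_translate that) measurable
      also have "\<dots> = (\<integral>\<^sup>+(x, z). ennreal (\<phi> (x + \<epsilon> *\<^sub>R z)) * ennreal (gauss_kernel 1 z) \<partial>(\<nu> \<Otimes>\<^sub>M lborel))"
        by (subst lborel.nn_integral_fst[symmetric]) auto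
      finally show ?thesis .
    qed
    have gk: "(\<integral>\<^sup>+(x, z). ennreal (gauss_kernel 1 z) \<partial>(\<nu> \<Otimes>\<^sub>M (lborel :: 'a measure))) = 1"
      by (subst lborel.nn_integral_fst[symmetric]) (auto simp: gauss_kernel_prob emeasure_space_1)
    have L1: "(\<lambda>m. \<integral>\<^sup>+y. ennreal (\<phi> y) * ennreal (p (\<delta> m) y) \<partial>lborel) \<longlonglongrightarrow> (\<integral>\<^sup>+y. ennreal (\<phi> y) * ennreal (F y) \<partial>lborel)"
    proof (rule nn_integral_dominated_convergence[where w="\<lambda>y. ennreal C * indicator ?S y"])
      show "AE y in lborel. ennreal (\<phi> y) * ennreal (p (\<delta> m) y) \<le> ennreal C * indicator ?S y" for m
      proof (rule AE_I2)
        fix y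
        show "ennreal (\<phi> y) * ennreal (p (\<delta> m) y) \<le> ennreal C * indicator ?S y"
        proof (cases "\<phi> y = 0")
          case False
          then have "y \<in> ?S" by (intro subsetD[OF closure_subset]) simp
          moreover have "ennreal (\<phi> y) * ennreal (p (\<delta> m) y) \<le> 1 * ennreal C"
            using \<phi>(2)[of y] p_le[OF \<delta>] by (intro mult_mono ennreal_leI) auto
          ultimately show ?thesis by simp
        qed simp
      qed
      show "(\<integral>\<^sup>+y. ennreal C * indicator ?S y \<partial>lborel) < \<infinity>"
        using fin by (simp add: nn_integral_cmult ennreal_mult_less_top)
      show "AE y in lborel. (\<lambda>m. ennreal (\<phi> y) * ennreal (p (\<delta> m) y)) \<longlonglongrightarrow> ennreal (\<phi> y) * ennreal (F y)"
        using pF by (intro AE_I2 tendsto_mult_ennreal tendsto_ennrealI) auto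
    qed auto
    have L2: "(\<lambda>m. \<integral>\<^sup>+(x, z). ennreal (\<phi> (x + \<delta> m *\<^sub>R z)) * ennreal (gauss_kernel 1 z) \<partial>(\<nu> \<Otimes>\<^sub>M lborel))
        \<longlonglongrightarrow> (\<integral>\<^sup>+(x, z). ennreal (\<phi> x) * ennreal (gauss_kernel 1 z) \<partial>(\<nu> \<Otimes>\<^sub>M (lborel :: 'a measure)))"
    proof (rule nn_integral_dominated_convergence[where w="\<lambda>(x, z). ennreal (gauss_kernel 1 z)"])
      show "(\<integral>\<^sup>+(x, z). ennreal (gauss_kernel 1 z) \<partial>(\<nu> \<Otimes>\<^sub>M (lborel :: 'a measure))) < \<infinity>"
        by (simp add: gk)
      show "AE q in \<nu> \<Otimes>\<^sub>M lborel. (case q of (x, z) \<Rightarrow> ennreal (\<phi> (x + \<delta> m *\<^sub>R z)) * ennreal (gauss_kernel 1 z))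
          \<le> (case q of (x, z) \<Rightarrow> ennreal (gauss_kernel 1 z))" for m
      proof (rule AE_I2, clarsimp)
        fix x z :: 'a
        have "ennreal (\<phi> (x + \<delta> m *\<^sub>R z)) * ennreal (gauss_kernel 1 z) \<le> 1 * ennreal (gauss_kernel 1 z)"
          using \<phi>(2) by (intro mult_right_mono) auto
        then show "ennreal (\<phi> (x + \<delta> m *\<^sub>R z)) * ennreal (gauss_kernel 1 z) \<le> ennreal (gauss_kernel 1 z)" by simp
      qed
      show "AE q in \<nu> \<Otimes>\<^sub>M lborel. (\<lambda>m. case q of (x, z) \<Rightarrow> ennreal (\<phi> (x + \<delta> m *\<^sub>R z)) * ennreal (gauss_kernel 1 z))
          \<longlonglongrightarrow> (case q of (x, z) \<Rightarrow> ennreal (\<phi> x) * ennreal (gauss_kernel 1 z))"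
      proof (rule AE_I2, clarsimp)
        fix x z :: 'a
        have "(\<lambda>m. x + \<delta> m *\<^sub>R z) \<longlonglongrightarrow> x + 0 *\<^sub>R z" by (intro tendsto_intros \<delta>0)
        then have "(\<lambda>m. \<phi> (x + \<delta> m *\<^sub>R z)) \<longlonglongrightarrow> \<phi> x"
          using \<phi>(1) by (auto intro!: isCont_tendsto_compose[of x \<phi>] simp: continuous_on_eq_continuous_at)
        then show "(\<lambda>m. ennreal (\<phi> (x + \<delta> m *\<^sub>R z)) * ennreal (gauss_kernel 1 z)) \<longlonglongrightarrow> ennreal (\<phi> x) * ennreal (gauss_kernel 1 z)"
          by (intro tendsto_mult_ennreal tendsto_ennrealI) auto
      qed
    qed measurable
    have "(\<integral>\<^sup>+x. ennreal (\<phi> x) \<partial>\<nu>) = (\<integral>\<^sup>+(x, z). ennreal (\<phi> x) * ennreal (gauss_kernel 1 z) \<partial>(\<nu> \<Otimes>\<^sub>M (lborel :: 'a measure)))"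
      by (subst lborel.nn_integral_fst[symmetric]) (auto simp: nn_integral_cmult gauss_kernel_prob)
    then show "(\<integral>\<^sup>+x. ennreal (\<phi> x) \<partial>\<nu>) = (\<integral>\<^sup>+x. ennreal (\<phi> x) * ennreal (F x) \<partial>lborel)"
      using L1 L2 LIMSEQ_unique unfolding swap[OF \<delta>] by auto
  qed measurable
  then show ?thesis using that F_cont F_nonneg by blast
qed

section \<open>Averages of hyperplane integrals\<close>

lemma nn_integral_lborel_translate:
  fixes f :: "'a::euclidean_space \<Rightarrow> ennreal"
  assumes [measurable]: "f \<in> borel_measurable borel"
  shows "(\<integral>\<^sup>+x. f (x + c) \<partial>lborel) = (\<integral>\<^sup>+x. f x \<partial>lborel)"
proof -
  have "(\<integral>\<^sup>+x. f x \<partial>lborel) = (\<integral>\<^sup>+x. f x \<partial>distr lborel borel ((+) c))"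
    by (simp add: lborel_distr_plus)
  also have "\<dots> = (\<integral>\<^sup>+x. f (x + c) \<partial>lborel)"
    by (subst nn_integral_distr) (auto simp: add.commute)
  finally show ?thesis by simp
qed

text \<open>By translation invariance the integral over \<open>x\<close> does not change if \<open>x\<close> is replaced by \<open>x + t j\<close>, so it may
  also be averaged over \<open>t\<close> in \<open>{0..1}\<close>. Along such a segment \<open>x \<bullet> k\<close> is constant and the argument of \<open>h\<close> is
  affine in \<open>t\<close> with slope \<open>(\<eta> \<bullet> j) / (x \<bullet> k)\<close>, so each segment contributes at most
  \<open>m / \<bar>\<eta> \<bullet> j\<bar>\<close> times the integral of \<open>h\<close>.\<close>

lemma nn_integral_fibre_average:
  fixes \<eta> k j :: "'a::euclidean_space" and h :: "real \<Rightarrow> ennreal" and m :: real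
  defines "E \<equiv> {x::'a. norm x \<le> m \<and> 1 \<le> m * \<bar>x \<bullet> k\<bar>}"
  assumes [measurable]: "h \<in> borel_measurable borel"
    and kj: "k \<in> Basis" "j \<in> Basis" "j \<noteq> k" and \<eta>j: "\<eta> \<bullet> j \<noteq> 0" and m: "m > 0"
  shows "(\<integral>\<^sup>+x. indicator E x * h ((\<eta> \<bullet> x) / (x \<bullet> k)) \<partial>lborel)
    \<le> emeasure lborel (cball (0::'a) (m + 1)) * (ennreal (m / \<bar>\<eta> \<bullet> j\<bar>) * (\<integral>\<^sup>+s. h s \<partial>lborel))"
proof -
  define G where "G x = indicator E x * h ((\<eta> \<bullet> x) / (x \<bullet> k))" for x
  have [measurable]: "E \<in> sets borel" unfolding E_def by measurable
  have G [measurable]: "G \<in> borel_measurable borel" unfolding G_def by measurable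
  have jk: "j \<bullet> k = 0" using kj by (simp add: inner_Basis)
  have "(\<integral>\<^sup>+x. G x \<partial>lborel) = (\<integral>\<^sup>+t. indicator {0..1::real} t * (\<integral>\<^sup>+x. G x \<partial>lborel) \<partial>lborel)"
    by (simp add: nn_integral_multc)
  also have "\<dots> = (\<integral>\<^sup>+t. (\<integral>\<^sup>+x. indicator {0..1::real} t * G (x + t *\<^sub>R j) \<partial>lborel) \<partial>lborel)"
    by (simp add: nn_integral_cmult nn_integral_lborel_translate)
  also have "\<dots> = (\<integral>\<^sup>+x. (\<integral>\<^sup>+t. indicator {0..1::real} t * G (x + t *\<^sub>R j) \<partial>lborel) \<partial>lborel)"
    by (rule lborel_pair.Fubini') measurable
  also have "\<dots> \<le> (\<integral>\<^sup>+x. indicator (cball (0::'a) (m + 1)) x * (ennreal (m / \<bar>\<eta> \<bullet> j\<bar>) * (\<integral>\<^sup>+s. h s \<partial>lborel)) \<partial>lborel)"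
  proof (rule nn_integral_mono)
    fix x :: 'a
    show "(\<integral>\<^sup>+t. indicator {0..1::real} t * G (x + t *\<^sub>R j) \<partial>lborel)
      \<le> indicator (cball (0::'a) (m + 1)) x * (ennreal (m / \<bar>\<eta> \<bullet> j\<bar>) * (\<integral>\<^sup>+s. h s \<partial>lborel))"
    proof (cases "\<exists>t\<in>{0..1}. x + t *\<^sub>R j \<in> E")
      case False
      then have zero: "indicator {0..1::real} t * G (x + t *\<^sub>R j) = 0" for t
        by (auto simp: G_def indicator_def)
      show ?thesis unfolding zero by simp
    next
      case True
      then obtain t where t: "t \<in> {0..1}" and E: "norm (x + t *\<^sub>R j) \<le> m" "1 \<le> m * \<bar>x \<bullet> k\<bar>"
        by (auto simp: E_def inner_add_left jk)
      have "norm x \<le> norm (x + t *\<^sub>R j) + norm (t *\<^sub>R j)"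
        by (metis add_diff_cancel_right' norm_triangle_ineq4)
      also have "\<dots> \<le> m + 1" using E t kj(2) by (auto simp: norm_Basis)
      finally have x: "x \<in> cball 0 (m + 1)" by simp
      have xk: "x \<bullet> k \<noteq> 0" using E by auto
      have "\<bar>x \<bullet> k\<bar> = \<bar>(x + t *\<^sub>R j) \<bullet> k\<bar>" by (simp add: inner_add_left jk)
      also have "\<dots> \<le> norm (x + t *\<^sub>R j)" using kj(1) Basis_le_norm by blast
      finally have xkm: "\<bar>x \<bullet> k\<bar> \<le> m" using E by linarith
      define c where "c = (\<eta> \<bullet> j) / (x \<bullet> k)"
      define d where "d = (\<eta> \<bullet> x) / (x \<bullet> k)"
      have c: "c \<noteq> 0" using xk \<eta>j by (simp add: c_def)
      have "(\<integral>\<^sup>+t. indicator {0..1::real} t * G (x + t *\<^sub>R j) \<partial>lborel) \<le> (\<integral>\<^sup>+t. h (d + c * t) \<partial>lborel)"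
      proof (rule nn_integral_mono)
        fix t
        have "(\<eta> \<bullet> (x + t *\<^sub>R j)) / ((x + t *\<^sub>R j) \<bullet> k) = d + c * t"
          by (simp add: inner_add_left inner_add_right jk c_def d_def add_divide_distrib)
        then show "indicator {0..1::real} t * G (x + t *\<^sub>R j) \<le> h (d + c * t)"
          by (simp add: G_def indicator_def)
      qed
      also have "\<dots> = ennreal (1 / \<bar>c\<bar>) * (ennreal \<bar>c\<bar> * (\<integral>\<^sup>+t. h (d + c * t) \<partial>lborel))"
        using c by (simp add: mult.assoc[symmetric] ennreal_mult[symmetric])
      also have "\<dots> = ennreal (1 / \<bar>c\<bar>) * (\<integral>\<^sup>+s. h s \<partial>lborel)"
        using c by (subst nn_integral_real_affine[of h c d]) auto
      also have "\<dots> \<le> ennreal (m / \<bar>\<eta> \<bullet> j\<bar>) * (\<integral>\<^sup>+s. h s \<partial>lborel)"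
        using xkm by (intro mult_right_mono ennreal_leI) (auto simp: c_def divide_right_mono)
      finally show ?thesis using x by simp
    qed
  qed
  also have "\<dots> = emeasure lborel (cball (0::'a) (m + 1)) * (ennreal (m / \<bar>\<eta> \<bullet> j\<bar>) * (\<integral>\<^sup>+s. h s \<partial>lborel))"
    by (subst nn_integral_multc) (auto intro!: borel_measurable_indicator borel_closed)
  finally show ?thesis by (simp add: G_def)
qed

lemma AE_coordinate_nonzero:
  fixes b :: "'a::euclidean_space"
  assumes "b \<in> Basis"
  shows "AE x in lborel. x \<bullet> b \<noteq> 0"
proof -
  have "negligible {x. b \<bullet> x = 0}"
    by (rule negligible_hyperplane) (use assms in auto)
  then have "{x. b \<bullet> x = 0} \<in> null_sets lebesgue"
    by (simp add: negligible_iff_null_sets)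
  then have "{x. b \<bullet> x = 0} \<in> null_sets lborel"
    using null_sets_completion_iff[of "{x. b \<bullet> x = 0}" lborel] by (simp add: closed_hyperplane)
  from AE_not_in[OF this] show ?thesis by eventually_elim (simp add: inner_commute)
qed

text \<open>On the hyperplane orthogonal to \<open>x\<close>, the \<open>k\<close>-th coordinate is a linear combination of the others with
  coefficients at most \<open>m\<^sup>2\<close>, because \<open>\<bar>x \<bullet> k\<bar>\<close> is at least \<open>1 / m\<close>. Hence the largest of the other
  coordinates controls the norm.\<close>

lemma norm_le_transversal_coordinates:
  fixes \<zeta> x k j :: "'a::euclidean_space"
  assumes k: "k \<in> Basis" and perp: "\<zeta> \<bullet> x = 0" and x: "norm x \<le> m" "1 \<le> m * \<bar>x \<bullet> k\<bar>"
    and max: "\<And>b. b \<in> Basis - {k} \<Longrightarrow> \<bar>\<zeta> \<bullet> b\<bar> \<le> \<bar>\<zeta> \<bullet> j\<bar>"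
  shows "norm \<zeta> \<le> real DIM('a) * (m\<^sup>2 + 1) * \<bar>\<zeta> \<bullet> j\<bar>"
proof -
  let ?S = "\<Sum>b\<in>Basis - {k}. \<bar>\<zeta> \<bullet> b\<bar>"
  have m: "0 \<le> m" using x(1) norm_ge_zero order_trans by blast
  have S: "?S \<le> real DIM('a) * \<bar>\<zeta> \<bullet> j\<bar>"
  proof -
    have "?S \<le> of_nat (card (Basis - {k} :: 'a set)) * \<bar>\<zeta> \<bullet> j\<bar>"
      by (rule sum_bounded_above) (use max in auto)
    also have "\<dots> \<le> real DIM('a) * \<bar>\<zeta> \<bullet> j\<bar>"
      by (intro mult_right_mono) (auto intro!: card_mono)
    finally show ?thesis .
  qed
  have "0 = (\<zeta> \<bullet> k) * (x \<bullet> k) + (\<Sum>b\<in>Basis - {k}. (\<zeta> \<bullet> b) * (x \<bullet> b))"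
    using perp by (subst (asm) euclidean_inner) (simp add: sum.remove[OF finite_Basis k])
  then have "\<bar>\<zeta> \<bullet> k\<bar> * \<bar>x \<bullet> k\<bar> = \<bar>\<Sum>b\<in>Basis - {k}. (\<zeta> \<bullet> b) * (x \<bullet> b)\<bar>"
    by (simp add: abs_mult[symmetric] eq_neg_iff_add_eq_0[symmetric])
  also have "\<dots> \<le> (\<Sum>b\<in>Basis - {k}. \<bar>\<zeta> \<bullet> b\<bar> * m)"
    using x(1) by (intro order_trans[OF sum_abs] sum_mono)
      (auto simp: abs_mult intro!: mult_left_mono order_trans[OF Basis_le_norm])
  finally have 1: "\<bar>\<zeta> \<bullet> k\<bar> * \<bar>x \<bullet> k\<bar> \<le> ?S * m" by (simp add: sum_distrib_right)
  have "\<bar>\<zeta> \<bullet> k\<bar> \<le> \<bar>\<zeta> \<bullet> k\<bar> * (m * \<bar>x \<bullet> k\<bar>)"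
    using x(2) by (simp add: mult_left_le mult_le_cancel_left1)
  also have "\<dots> = m * (\<bar>\<zeta> \<bullet> k\<bar> * \<bar>x \<bullet> k\<bar>)" by simp
  also have "\<dots> \<le> m * (?S * m)" using 1 m by (rule mult_left_mono)
  finally have 2: "\<bar>\<zeta> \<bullet> k\<bar> \<le> m\<^sup>2 * ?S" by (simp add: power2_eq_square mult_ac)
  have "norm \<zeta> \<le> (\<Sum>b\<in>Basis. \<bar>\<zeta> \<bullet> b\<bar>)" by (rule norm_le_l1)
  also have "\<dots> = \<bar>\<zeta> \<bullet> k\<bar> + ?S" by (simp add: sum.remove[OF finite_Basis k])
  also have "\<dots> \<le> (m\<^sup>2 + 1) * ?S" using 2 by (simp add: algebra_simps)
  also have "\<dots> \<le> (m\<^sup>2 + 1) * (real DIM('a) * \<bar>\<zeta> \<bullet> j\<bar>)" using S by (intro mult_left_mono) auto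
  finally show ?thesis by (simp add: mult_ac)
qed

text \<open>Put \<open>s = (\<eta> \<bullet> x) / (x \<bullet> k)\<close>. The map \<open>\<eta> \<mapsto> \<eta> - s k\<close> is the projection along \<open>k\<close> onto the hyperplane
  orthogonal to \<open>x\<close>, and \<open>w s\<close> weights the position along \<open>k\<close>. So the integral over \<open>\<eta>\<close> is the integral of \<open>g\<close>
  over this hyperplane times that of \<open>w\<close>, up to the factor \<open>\<bar>x \<bullet> k\<bar> / |x|\<close>; written over the whole space it
  depends measurably on \<open>x\<close> and needs no choice of coordinates in the hyperplanes.

  The lemma is the integral-geometric bound "the average over \<open>x\<close>, in a bounded set on which
  \<open>\<bar>x \<bullet> k\<bar>\<close> is bounded below, of the integral of \<open>g\<close> over the hyperplane
  orthogonal to \<open>x\<close> is at most a constant times the integral of \<open>g \<eta> / |\<eta>|\<close>". Exchange the integrals and fix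
  \<open>\<eta>\<close>; let \<open>j\<close> be the basis vector other than \<open>k\<close> with the largest coordinate of \<open>\<eta>\<close>. As \<open>x\<close> varies, the
  projected point moves along the line \<open>\<eta> + \<real> k\<close>, with a density of order at most \<open>1 / \<bar>\<eta> \<bullet> j\<bar>\<close>, hence at most
  \<open>1 / |\<eta> - s k|\<close> up to a constant. The remaining integral over \<open>s\<close> and \<open>\<eta>\<close> splits into a product after translating \<open>\<eta>\<close>
  by \<open>s k\<close>.\<close>

lemma AE_hyperplane_integral_finite:
  fixes g :: "'a::euclidean_space \<Rightarrow> ennreal" and w :: "real \<Rightarrow> ennreal" and k :: 'a
  assumes [measurable]: "g \<in> borel_measurable borel" "w \<in> borel_measurable borel"
    and k: "k \<in> Basis" and dim: "DIM('a) \<ge> 2"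
    and w: "(\<integral>\<^sup>+s. w s \<partial>lborel) < \<infinity>"
    and g: "(\<integral>\<^sup>+\<eta>. g \<eta> * ennreal (1 / norm \<eta>) \<partial>lborel) < \<infinity>"
  shows "AE x in lborel. (\<integral>\<^sup>+\<eta>. g (\<eta> - ((\<eta> \<bullet> x) / (x \<bullet> k)) *\<^sub>R k) * w ((\<eta> \<bullet> x) / (x \<bullet> k)) \<partial>lborel) < \<infinity>"
proof -
  define J where "J x = (\<integral>\<^sup>+\<eta>. g (\<eta> - ((\<eta> \<bullet> x) / (x \<bullet> k)) *\<^sub>R k) * w ((\<eta> \<bullet> x) / (x \<bullet> k)) \<partial>lborel)" for x
  have J [measurable]: "J \<in> borel_measurable borel" unfolding J_def by measurable
  define q where "q \<eta> = g \<eta> * ennreal (1 / norm \<eta>)" for \<eta>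
  have q [measurable]: "q \<in> borel_measurable borel" unfolding q_def by measurable
  have "\<exists>j0\<in>Basis. j0 \<noteq> k"
  proof (rule ccontr)
    assume "\<not> ?thesis"
    then have "Basis \<subseteq> {k}" by auto
    then have "DIM('a) \<le> card {k}" by (intro card_mono) auto
    then show False using dim by simp
  qed
  then obtain j0 where j0: "j0 \<in> Basis" "j0 \<noteq> k" by blast
  have AE_m: "AE x in lborel. x \<in> {x. norm x \<le> m \<and> 1 \<le> m * \<bar>x \<bullet> k\<bar>} \<longrightarrow> J x < \<infinity>" if m: "m > 0" for m :: real
  proof -
    define E where "E = {x::'a. norm x \<le> m \<and> 1 \<le> m * \<bar>x \<bullet> k\<bar>}"
    have [measurable]: "E \<in> sets borel" unfolding E_def by measurable
    \<comment> \<open>The constant with which the \<open>j\<close>-th coordinate controls the norm of a point of the hyperplane.\<close>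
    define D where "D = real DIM('a) * (m\<^sup>2 + 1)"
    have D: "D > 0" unfolding D_def by (intro mult_pos_pos) (auto simp: add_nonneg_pos)
    define K where "K = emeasure lborel (cball (0::'a) (m + 1)) * ennreal (m * D)"
    have fibre: "(\<integral>\<^sup>+x. indicator E x * (g (\<eta> - ((\<eta> \<bullet> x) / (x \<bullet> k)) *\<^sub>R k) * w ((\<eta> \<bullet> x) / (x \<bullet> k))) \<partial>lborel)
        \<le> K * (\<integral>\<^sup>+s. q (\<eta> - s *\<^sub>R k) * w s \<partial>lborel)" if \<eta>: "\<eta> \<bullet> j0 \<noteq> 0" for \<eta>
    proof -
      let ?S = "(\<lambda>b. \<bar>\<eta> \<bullet> b\<bar>) ` (Basis - {k})"
      have S: "finite ?S" "?S \<noteq> {}" using j0 by auto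
      obtain j where j: "j \<in> Basis - {k}" and Max: "Max ?S = \<bar>\<eta> \<bullet> j\<bar>"
        using Max_in[OF S] by auto
      have max: "\<bar>\<eta> \<bullet> b\<bar> \<le> \<bar>\<eta> \<bullet> j\<bar>" if "b \<in> Basis - {k}" for b
        using Max_ge[OF S(1)] that unfolding Max by blast
      have \<eta>j: "\<eta> \<bullet> j \<noteq> 0" using max[of j0] j0 \<eta> by auto
      \<comment> \<open>The indicator records a constraint that the points met for \<open>x \<in> E\<close> satisfy anyway; it is what permits \<open>1 / \<bar>\<eta> \<bullet> j\<bar>\<close> to be traded for \<open>1 / |\<eta> - s k|\<close> after the average.\<close>
      define h where "h s = g (\<eta> - s *\<^sub>R k) * w s * indicator {s. norm (\<eta> - s *\<^sub>R k) \<le> D * \<bar>\<eta> \<bullet> j\<bar>} s" for s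
      have h [measurable]: "h \<in> borel_measurable borel" unfolding h_def by measurable
      have "(\<integral>\<^sup>+x. indicator E x * (g (\<eta> - ((\<eta> \<bullet> x) / (x \<bullet> k)) *\<^sub>R k) * w ((\<eta> \<bullet> x) / (x \<bullet> k))) \<partial>lborel)
          \<le> (\<integral>\<^sup>+x. indicator E x * h ((\<eta> \<bullet> x) / (x \<bullet> k)) \<partial>lborel)"
      proof (rule nn_integral_mono)
        fix x :: 'a
        show "indicator E x * (g (\<eta> - ((\<eta> \<bullet> x) / (x \<bullet> k)) *\<^sub>R k) * w ((\<eta> \<bullet> x) / (x \<bullet> k)))
          \<le> indicator E x * h ((\<eta> \<bullet> x) / (x \<bullet> k))"
        proof (cases "x \<in> E")
          case True
          define s where "s = (\<eta> \<bullet> x) / (x \<bullet> k)"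
          have x: "norm x \<le> m" "1 \<le> m * \<bar>x \<bullet> k\<bar>" using True by (auto simp: E_def)
          then have xk: "x \<bullet> k \<noteq> 0" by auto
          have coord: "(\<eta> - s *\<^sub>R k) \<bullet> b = \<eta> \<bullet> b" if "b \<in> Basis - {k}" for b
            using that k by (auto simp: inner_diff_left inner_Basis)
          have "norm (\<eta> - s *\<^sub>R k) \<le> D * \<bar>(\<eta> - s *\<^sub>R k) \<bullet> j\<bar>"
            unfolding D_def
          proof (rule norm_le_transversal_coordinates[OF k _ x])
            show "(\<eta> - s *\<^sub>R k) \<bullet> x = 0"
              using xk by (simp add: inner_diff_left s_def inner_commute[of k x])
          qed (use coord j max in auto)
          then have "norm (\<eta> - s *\<^sub>R k) \<le> D * \<bar>\<eta> \<bullet> j\<bar>" using coord[OF j] by simp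
          then show ?thesis by (simp add: h_def s_def[symmetric])
        qed simp
      qed
      also have "\<dots> \<le> emeasure lborel (cball (0::'a) (m + 1)) * (ennreal (m / \<bar>\<eta> \<bullet> j\<bar>) * (\<integral>\<^sup>+s. h s \<partial>lborel))"
        unfolding E_def using k j \<eta>j m by (intro nn_integral_fibre_average h) auto
      also have "\<dots> = emeasure lborel (cball (0::'a) (m + 1)) * (\<integral>\<^sup>+s. ennreal (m / \<bar>\<eta> \<bullet> j\<bar>) * h s \<partial>lborel)"
        by (simp add: nn_integral_cmult)
      also have "\<dots> \<le> emeasure lborel (cball (0::'a) (m + 1)) * (\<integral>\<^sup>+s. ennreal (m * D) * (q (\<eta> - s *\<^sub>R k) * w s) \<partial>lborel)"
      proof (intro mult_left_mono nn_integral_mono)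
        fix s
        show "ennreal (m / \<bar>\<eta> \<bullet> j\<bar>) * h s \<le> ennreal (m * D) * (q (\<eta> - s *\<^sub>R k) * w s)"
        proof (cases "norm (\<eta> - s *\<^sub>R k) \<le> D * \<bar>\<eta> \<bullet> j\<bar>")
          case True
          have "(\<eta> - s *\<^sub>R k) \<bullet> j = \<eta> \<bullet> j"
            using j k by (auto simp: inner_diff_left inner_Basis)
          then have pos: "0 < norm (\<eta> - s *\<^sub>R k)" using \<eta>j by auto
          then have "m / \<bar>\<eta> \<bullet> j\<bar> \<le> m * D * (1 / norm (\<eta> - s *\<^sub>R k))"
            using True \<eta>j m by (simp add: field_simps)
          then have "ennreal (m / \<bar>\<eta> \<bullet> j\<bar>) \<le> ennreal (m * D * (1 / norm (\<eta> - s *\<^sub>R k)))"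
            by (rule ennreal_leI)
          also have "\<dots> = ennreal (m * D) * ennreal (1 / norm (\<eta> - s *\<^sub>R k))"
            using m D by (intro ennreal_mult) auto
          finally have "ennreal (m / \<bar>\<eta> \<bullet> j\<bar>) * (g (\<eta> - s *\<^sub>R k) * w s)
              \<le> ennreal (m * D) * ennreal (1 / norm (\<eta> - s *\<^sub>R k)) * (g (\<eta> - s *\<^sub>R k) * w s)"
            by (rule mult_right_mono) simp
          then show ?thesis using True by (simp add: h_def q_def mult_ac)
        qed (simp add: h_def)
      qed simp
      also have "\<dots> = K * (\<integral>\<^sup>+s. q (\<eta> - s *\<^sub>R k) * w s \<partial>lborel)"
        unfolding K_def by (subst nn_integral_cmult) (auto simp: mult.assoc)
      finally show ?thesis .
    qed
    have "(\<integral>\<^sup>+x. indicator E x * J x \<partial>lborel)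
        = (\<integral>\<^sup>+x. (\<integral>\<^sup>+\<eta>. indicator E x * (g (\<eta> - ((\<eta> \<bullet> x) / (x \<bullet> k)) *\<^sub>R k) * w ((\<eta> \<bullet> x) / (x \<bullet> k))) \<partial>lborel) \<partial>lborel)"
      unfolding J_def by (intro nn_integral_cong nn_integral_cmult[symmetric]) measurable
    also have "\<dots> = (\<integral>\<^sup>+\<eta>. (\<integral>\<^sup>+x. indicator E x * (g (\<eta> - ((\<eta> \<bullet> x) / (x \<bullet> k)) *\<^sub>R k) * w ((\<eta> \<bullet> x) / (x \<bullet> k))) \<partial>lborel) \<partial>lborel)"
      by (rule lborel_pair.Fubini') measurable
    also have "\<dots> \<le> (\<integral>\<^sup>+\<eta>. K * (\<integral>\<^sup>+s. q (\<eta> - s *\<^sub>R k) * w s \<partial>lborel) \<partial>lborel)"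
      by (rule nn_integral_mono_AE) (use AE_coordinate_nonzero[OF j0(1)] fibre in auto)
    also have "\<dots> = K * (\<integral>\<^sup>+\<eta>. (\<integral>\<^sup>+s. q (\<eta> - s *\<^sub>R k) * w s \<partial>lborel) \<partial>lborel)"
      by (rule nn_integral_cmult) measurable
    also have "(\<integral>\<^sup>+\<eta>. (\<integral>\<^sup>+s. q (\<eta> - s *\<^sub>R k) * w s \<partial>lborel) \<partial>lborel)
        = (\<integral>\<^sup>+s. (\<integral>\<^sup>+\<eta>. q (\<eta> - s *\<^sub>R k) * w s \<partial>lborel) \<partial>lborel)"
      by (rule lborel_pair.Fubini') measurable
    also have "\<dots> = (\<integral>\<^sup>+s. (\<integral>\<^sup>+\<eta>. q \<eta> \<partial>lborel) * w s \<partial>lborel)"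
    proof (rule nn_integral_cong)
      fix s
      show "(\<integral>\<^sup>+\<eta>. q (\<eta> - s *\<^sub>R k) * w s \<partial>lborel) = (\<integral>\<^sup>+\<eta>. q \<eta> \<partial>lborel) * w s"
        using nn_integral_lborel_translate[OF q, of "- (s *\<^sub>R k)"] by (simp add: nn_integral_multc)
    qed
    also have "\<dots> = (\<integral>\<^sup>+\<eta>. q \<eta> \<partial>lborel) * (\<integral>\<^sup>+s. w s \<partial>lborel)"
      by (rule nn_integral_cmult) measurable
    also have "K * \<dots> < \<infinity>"
    proof -
      have "emeasure lborel (cball (0::'a) (m + 1)) < \<infinity>"
        by (rule emeasure_bounded_finite) simp
      then show ?thesis using w g by (auto simp: K_def q_def ennreal_mult_less_top)
    qed
    finally have "(\<integral>\<^sup>+x. indicator E x * J x \<partial>lborel) \<noteq> \<infinity>" by simp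
    then have "AE x in lborel. indicator E x * J x \<noteq> \<infinity>"
      by (intro nn_integral_noteq_infinite) measurable
    then show ?thesis
      unfolding E_def[symmetric] by eventually_elim (auto simp: less_top)
  qed
  have "AE x in lborel. \<forall>n. x \<in> {x. norm x \<le> real (Suc n) \<and> 1 \<le> real (Suc n) * \<bar>x \<bullet> k\<bar>} \<longrightarrow> J x < \<infinity>"
    unfolding AE_all_countable by (intro allI AE_m) simp
  moreover have "AE x in lborel. (x::'a) \<bullet> k \<noteq> 0" by (rule AE_coordinate_nonzero[OF k])
  ultimately have "AE x in lborel. J x < \<infinity>"
  proof eventually_elim
    fix x :: 'a
    assume J: "\<forall>n. x \<in> {x. norm x \<le> real (Suc n) \<and> 1 \<le> real (Suc n) * \<bar>x \<bullet> k\<bar>} \<longrightarrow> J x < \<infinity>"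
      and xk: "x \<bullet> k \<noteq> 0"
    obtain n :: nat where n: "max (norm x) (1 / \<bar>x \<bullet> k\<bar>) < real n" using reals_Archimedean2 by blast
    then have "norm x \<le> real (Suc n)" by simp
    moreover have "1 \<le> real (Suc n) * \<bar>x \<bullet> k\<bar>"
    proof -
      have "1 / \<bar>x \<bullet> k\<bar> \<le> real (Suc n)" using n by simp
      then show ?thesis using xk by (simp add: pos_divide_le_eq)
    qed
    ultimately show "J x < \<infinity>" using J by blast
  qed
  then show ?thesis by (simp add: J_def)
qed

section \<open>From lattice sums to a weighted integral of the transform\<close>

text \<open>Write \<open>1 / |\<eta>|\<close> as the integral of \<open>1 / r\<^sup>2\<close> over \<open>r \<ge> |\<eta>|\<close> and exchange the integrals. The mass of \<open>g\<close>
  in the ball of radius \<open>r\<close> is \<open>O(r\<^sup>2)\<close> for \<open>r \<le> 1\<close>, since \<open>g \<le> 1\<close> and the dimension is at least 2, and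
  \<open>O(r powr a)\<close> for \<open>r \<ge> 1\<close>; against \<open>1 / r\<^sup>2\<close> both ranges converge, the second because \<open>a < 1\<close>.\<close>

lemma riesz_integral_finite:
  fixes g :: "'a::euclidean_space \<Rightarrow> ennreal"
  assumes [measurable]: "g \<in> borel_measurable borel" and g1: "\<And>\<eta>. g \<eta> \<le> 1"
    and dim: "DIM('a) \<ge> 2" and a: "a < 1" and C: "C \<ge> 0"
    and growth: "\<And>R. R \<ge> 1 \<Longrightarrow> (\<integral>\<^sup>+\<eta>. g \<eta> * indicator (cball 0 R) \<eta> \<partial>lborel) \<le> ennreal (C * R powr a)"
  shows "(\<integral>\<^sup>+\<eta>. g \<eta> * ennreal (1 / norm \<eta>) \<partial>lborel) < \<infinity>"
proof -
  define V where "V = unit_ball_vol (real DIM('a))"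
  have V: "V \<ge> 0" by (simp add: V_def)
  define G where "G r = (\<integral>\<^sup>+\<eta>. g \<eta> * indicator (cball 0 r) \<eta> \<partial>lborel)" for r
  have layer: "ennreal (1 / norm \<eta>) \<le> (\<integral>\<^sup>+r. ennreal (1 / r\<^sup>2) * indicator {norm \<eta>..} r \<partial>lborel)" for \<eta> :: 'a
  proof (cases "\<eta> = 0")
    case False
    have "(\<integral>\<^sup>+r. ennreal (1 / r\<^sup>2) * indicator {norm \<eta>..} r \<partial>lborel) = ennreal (0 - (- (1 / norm \<eta>)))"
    proof (rule nn_integral_FTC_atLeast)
      show "((\<lambda>r. - (1 / r)) has_real_derivative 1 / r\<^sup>2) (at r)" if "norm \<eta> \<le> r" for r
      proof -
        have "r \<noteq> 0" using that False by auto
        then show ?thesis by (auto intro!: derivative_eq_intros simp: power2_eq_square)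
      qed
      show "((\<lambda>r::real. - (1 / r)) \<longlongrightarrow> 0) at_top" by real_asymp
    qed auto
    then show ?thesis by simp
  qed simp
  have G_small: "G r \<le> ennreal (V * r\<^sup>2)" if "0 \<le> r" "r \<le> 1" for r
  proof -
    have "G r \<le> (\<integral>\<^sup>+\<eta>. indicator (cball (0::'a) r) \<eta> \<partial>lborel)"
      unfolding G_def by (intro nn_integral_mono) (use g1 in \<open>auto simp: indicator_def\<close>)
    also have "\<dots> = ennreal (V * r ^ DIM('a))"
      using that by (simp add: emeasure_cball V_def)
    also have "\<dots> \<le> ennreal (V * r\<^sup>2)"
      using that dim V by (intro ennreal_leI mult_left_mono power_decreasing) auto
    finally show ?thesis .
  qed
  have "(\<integral>\<^sup>+\<eta>. g \<eta> * ennreal (1 / norm \<eta>) \<partial>lborel)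
      \<le> (\<integral>\<^sup>+\<eta>. g \<eta> * (\<integral>\<^sup>+r. ennreal (1 / r\<^sup>2) * indicator {norm \<eta>..} r \<partial>lborel) \<partial>lborel)"
    by (intro nn_integral_mono mult_left_mono layer) simp
  also have "\<dots> = (\<integral>\<^sup>+\<eta>. (\<integral>\<^sup>+r. g \<eta> * (ennreal (1 / r\<^sup>2) * indicator {norm \<eta>..} r) \<partial>lborel) \<partial>lborel)"
    by (intro nn_integral_cong nn_integral_cmult[symmetric]) auto
  also have "\<dots> = (\<integral>\<^sup>+\<eta>. (\<integral>\<^sup>+r. ennreal (1 / r\<^sup>2) * (g \<eta> * indicator {\<eta>. norm \<eta> \<le> r} \<eta>) \<partial>lborel) \<partial>lborel)"
    by (intro nn_integral_cong) (auto simp: indicator_def mult.commute)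
  also have "\<dots> = (\<integral>\<^sup>+r. (\<integral>\<^sup>+\<eta>. ennreal (1 / r\<^sup>2) * (g \<eta> * indicator {\<eta>. norm \<eta> \<le> r} \<eta>) \<partial>lborel) \<partial>lborel)"
    by (rule lborel_pair.Fubini') measurable
  also have "\<dots> = (\<integral>\<^sup>+r. ennreal (1 / r\<^sup>2) * G r \<partial>lborel)"
    unfolding G_def cball_def by (intro nn_integral_cong) (simp add: nn_integral_cmult)
  also have "\<dots> \<le> (\<integral>\<^sup>+r. ennreal V * indicator {0..1} r + ennreal (C * r powr (a - 2)) * indicator {1..} r \<partial>lborel)"
  proof (rule nn_integral_mono)
    fix r :: real
    consider "r < 0" | "r = 0" | "0 < r" "r < 1" | "1 \<le> r" by linarith
    then show "ennreal (1 / r\<^sup>2) * G r \<le> ennreal V * indicator {0..1} r + ennreal (C * r powr (a - 2)) * indicator {1..} r"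
    proof cases
      case 3
      have "ennreal (1 / r\<^sup>2) * G r \<le> ennreal (1 / r\<^sup>2) * ennreal (V * r\<^sup>2)"
        using 3 by (intro mult_left_mono G_small) auto
      also have "\<dots> = ennreal V" using 3 V by (simp add: ennreal_mult[symmetric])
      finally show ?thesis using 3 by simp
    next
      case 4
      have "ennreal (1 / r\<^sup>2) * G r \<le> ennreal (1 / r\<^sup>2) * ennreal (C * r powr a)"
        using 4 growth unfolding G_def by (intro mult_left_mono) auto
      also have "\<dots> = ennreal (C * r powr (a - 2))"
        using 4 C by (simp add: ennreal_mult[symmetric] powr_diff powr_numeral)
      finally show ?thesis using 4 by (simp add: add_increasing)
    qed (auto simp: G_def)
  qed
  also have "\<dots> = ennreal V + (\<integral>\<^sup>+r. ennreal (C * r powr (a - 2)) * indicator {1..} r \<partial>lborel)"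
    by (subst nn_integral_add) (auto simp: nn_integral_cmult)
  also have "(\<integral>\<^sup>+r. ennreal (C * r powr (a - 2)) * indicator {1..} r \<partial>lborel) = ennreal (0 - C * (1 powr (a - 1) / (a - 1)))"
  proof (rule nn_integral_FTC_atLeast[where F="\<lambda>r. C * (r powr (a - 1) / (a - 1))"])
    show "((\<lambda>r. C * (r powr (a - 1) / (a - 1))) has_real_derivative C * r powr (a - 2)) (at r)" if "1 \<le> r" for r
    proof -
      have "((\<lambda>r. r powr (a - 1)) has_real_derivative (a - 1) * r powr (a - 1 - 1)) (at r)"
        using that by (intro has_real_derivative_powr) simp
      from DERIV_cmult[OF DERIV_cdivide[OF this, of "a - 1"], of C] show ?thesis
        using a by (simp add: diff_diff_eq)
    qed
    have "((\<lambda>r::real. r powr (a - 1)) \<longlongrightarrow> 0) at_top"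
      using a by (intro tendsto_neg_powr filterlim_ident) auto
    then have "((\<lambda>r. C * (r powr (a - 1) / (a - 1))) \<longlongrightarrow> C * (0 / (a - 1))) at_top"
      by (intro tendsto_intros) (use a in auto)
    then show "((\<lambda>r. C * (r powr (a - 1) / (a - 1))) \<longlongrightarrow> 0) at_top" by simp
  qed (use C in auto)
  also have "ennreal V + \<dots> < \<infinity>" by simp
  finally show ?thesis .
qed

lemma finite_lattice_ball: "finite (lattice_ball R :: (real ^ 'n) set)"
proof -
  let ?S = "of_int ` {- \<lceil>R\<rceil>..\<lceil>R\<rceil>} :: real set"
  have "lattice_ball R \<subseteq> vec_lambda ` (PiE (UNIV :: 'n set) (\<lambda>_. ?S))"
  proof
    fix \<xi> :: "real ^ 'n" assume \<xi>: "\<xi> \<in> lattice_ball R"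
    have "\<xi> $ i \<in> ?S" for i
    proof -
      from \<xi> obtain z where z: "\<xi> $ i = of_int z" by (auto simp: lattice_ball_def elim!: Ints_cases)
      have "\<bar>\<xi> $ i\<bar> \<le> R"
        using \<xi> component_le_norm_cart[of \<xi> i] by (auto simp: lattice_ball_def)
      then have "z \<in> {- \<lceil>R\<rceil>..\<lceil>R\<rceil>}" unfolding z by (auto simp: abs_le_iff) linarith+
      then show ?thesis using z by blast
    qed
    then show "\<xi> \<in> vec_lambda ` (PiE UNIV (\<lambda>_. ?S))"
      by (intro image_eqI[of _ _ "vec_nth \<xi>"]) auto
  qed
  then show ?thesis
    by (rule finite_subset) (intro finite_imageI finite_PiE; simp)
qed

lemma unit_cube_cbox: "unit_cube = cbox (0 :: real ^ 'n) 1"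
  by (auto simp: unit_cube_def mem_box_cart)

lemma norm_unit_cube_le:
  assumes "\<theta> \<in> (unit_cube :: (real ^ 'n) set)"
  shows "norm \<theta> \<le> real CARD('n)"
proof -
  have "norm \<theta> \<le> (\<Sum>i\<in>UNIV. \<bar>\<theta> $ i\<bar>)" by (rule norm_le_l1_cart)
  also have "\<dots> \<le> (\<Sum>i\<in>(UNIV :: 'n set). 1)"
    by (intro sum_mono) (use assms in \<open>auto simp: unit_cube_def\<close>)
  finally show ?thesis by simp
qed

text \<open>The unit cubes at the lattice points of norm at most \<open>R + n\<close> cover the ball of radius \<open>R\<close>: round every
  coordinate down. Translating all these cubes to the origin turns the integral over them into an integral
  over one unit cube of the lattice sums.\<close>

lemma ball_integral_le_lattice_sup:
  fixes g :: "real ^ 'n \<Rightarrow> real"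
  assumes [measurable]: "g \<in> borel_measurable borel" and g: "\<And>\<eta>. 0 \<le> g \<eta>" "\<And>\<eta>. g \<eta> \<le> 1"
  shows "(\<integral>\<^sup>+\<eta>. ennreal (g \<eta>) * indicator (cball 0 R) \<eta> \<partial>lborel)
    \<le> ennreal (SUP \<theta>\<in>unit_cube. \<Sum>\<xi>\<in>lattice_ball (R + real CARD('n)). g (\<xi> + \<theta>))"
proof -
  let ?L = "lattice_ball (R + real CARD('n)) :: (real ^ 'n) set"
  define S where "S = (SUP \<theta>\<in>unit_cube. \<Sum>\<xi>\<in>?L. g (\<xi> + \<theta>))"
  have fin: "finite ?L" by (rule finite_lattice_ball)
  have cube [measurable]: "(unit_cube :: (real ^ 'n) set) \<in> sets borel" by (simp add: unit_cube_cbox)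
  have S: "(\<Sum>\<xi>\<in>?L. g (\<xi> + \<theta>)) \<le> S" if "\<theta> \<in> unit_cube" for \<theta>
    unfolding S_def
  proof (rule cSUP_upper[OF that])
    have "(\<Sum>\<xi>\<in>?L. g (\<xi> + \<theta>)) \<le> real (card ?L)" for \<theta>
      using sum_bounded_above[of ?L "\<lambda>\<xi>. g (\<xi> + \<theta>)" 1] g by auto
    then show "bdd_above ((\<lambda>\<theta>. \<Sum>\<xi>\<in>?L. g (\<xi> + \<theta>)) ` unit_cube)" by (rule bdd_aboveI2)
  qed
  have cover: "indicator (cball 0 R) \<eta> \<le> (\<Sum>\<xi>\<in>?L. indicator unit_cube (\<eta> - \<xi>) :: ennreal)" for \<eta>
  proof (cases "norm \<eta> \<le> R")
    case True
    define \<xi> where "\<xi> = (\<chi> i. real_of_int \<lfloor>\<eta> $ i\<rfloor>)"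
    have c: "\<eta> - \<xi> \<in> unit_cube"
      by (auto simp: unit_cube_def \<xi>_def) linarith+
    have "norm \<xi> \<le> norm \<eta> + norm (\<eta> - \<xi>)"
      by (metis norm_minus_commute norm_triangle_sub)
    also have "\<dots> \<le> R + real CARD('n)" using True norm_unit_cube_le[OF c] by simp
    finally have "\<xi> \<in> ?L" by (simp add: lattice_ball_def \<xi>_def)
    then have "indicator unit_cube (\<eta> - \<xi>) \<le> (\<Sum>\<xi>\<in>?L. indicator unit_cube (\<eta> - \<xi>) :: ennreal)"
      using fin by (intro member_le_sum) auto
    then show ?thesis using True c by simp
  qed simp
  have "(\<integral>\<^sup>+\<eta>. ennreal (g \<eta>) * indicator (cball 0 R) \<eta> \<partial>lborel)
      \<le> (\<integral>\<^sup>+\<eta>. (\<Sum>\<xi>\<in>?L. ennreal (g \<eta>) * indicator unit_cube (\<eta> - \<xi>)) \<partial>lborel)"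
    unfolding sum_distrib_left[symmetric] by (intro nn_integral_mono mult_left_mono cover) simp
  also have "\<dots> = (\<Sum>\<xi>\<in>?L. \<integral>\<^sup>+\<eta>. ennreal (g \<eta>) * indicator unit_cube (\<eta> - \<xi>) \<partial>lborel)"
    by (intro nn_integral_sum) measurable
  also have "\<dots> = (\<Sum>\<xi>\<in>?L. \<integral>\<^sup>+\<theta>. ennreal (g (\<xi> + \<theta>)) * indicator unit_cube \<theta> \<partial>lborel)"
  proof (rule sum.cong[OF refl])
    fix \<xi> :: "real ^ 'n"
    have "(\<integral>\<^sup>+\<eta>. ennreal (g \<eta>) * indicator unit_cube (\<eta> - \<xi>) \<partial>lborel)
        = (\<integral>\<^sup>+\<theta>. ennreal (g (\<theta> + \<xi>)) * indicator unit_cube ((\<theta> + \<xi>) - \<xi>) \<partial>lborel)"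
      by (rule nn_integral_lborel_translate[symmetric]) measurable
    then show "(\<integral>\<^sup>+\<eta>. ennreal (g \<eta>) * indicator unit_cube (\<eta> - \<xi>) \<partial>lborel)
        = (\<integral>\<^sup>+\<theta>. ennreal (g (\<xi> + \<theta>)) * indicator unit_cube \<theta> \<partial>lborel)"
      by (simp add: add.commute)
  qed
  also have "\<dots> = (\<integral>\<^sup>+\<theta>. (\<Sum>\<xi>\<in>?L. ennreal (g (\<xi> + \<theta>)) * indicator unit_cube \<theta>) \<partial>lborel)"
    by (intro nn_integral_sum[symmetric]) measurable
  also have "\<dots> \<le> (\<integral>\<^sup>+\<theta>. ennreal S * indicator (unit_cube :: (real ^ 'n) set) \<theta> \<partial>lborel)"
  proof (rule nn_integral_mono)
    fix \<theta> :: "real ^ 'n"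
    show "(\<Sum>\<xi>\<in>?L. ennreal (g (\<xi> + \<theta>)) * indicator unit_cube \<theta>) \<le> ennreal S * indicator unit_cube \<theta>"
    proof (cases "\<theta> \<in> unit_cube")
      case True
      then show ?thesis using S[OF True] g by (simp add: sum_ennreal ennreal_leI)
    qed simp
  qed
  also have "\<dots> = ennreal S * emeasure lborel (unit_cube :: (real ^ 'n) set)"
    by (simp add: nn_integral_cmult)
  also have "emeasure lborel (unit_cube :: (real ^ 'n) set) = 1"
  proof -
    have one: "(1 :: real ^ 'n) \<bullet> b = 1" if "b \<in> Basis" for b
      using that by (auto simp: Basis_vec_def inner_axis)
    then show ?thesis
      by (simp add: unit_cube_cbox emeasure_lborel_cbox_eq)
  qed
  finally show ?thesis by (simp add: S_def)
qed

text \<open>Take an exponent \<open>s > n - 1\<close> admitted in the definition of the dimension. The lattice sums then bound the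
  integral of the transform over the ball of radius \<open>R\<close> by a multiple of \<open>R powr a\<close> with \<open>a < 1\<close>.\<close>

lemma fourier_energy_finite:
  fixes M :: "(real ^ 'n) measure"
  assumes n: "CARD('n) \<ge> 2" and M: "prob_space M" and sets_M: "sets M = sets borel"
    and dim: "dim_l1 M > ennreal (real CARD('n) - 1)"
  shows "(\<integral>\<^sup>+\<eta>. ennreal (cmod (fourier_transform M \<eta>)) * ennreal (1 / norm \<eta>) \<partial>lborel) < \<infinity>"
proof -
  let ?N = "real CARD('n)"
  let ?g = "\<lambda>\<eta>. cmod (fourier_transform M \<eta>)"
  have [measurable]: "fourier_transform M \<in> borel_measurable borel"
    using M sets_M by (intro fourier_transform_measurable prob_space.finite_measure)
  obtain s C where s: "s > ?N - 1"
    and C: "\<And>R. R \<ge> 1 \<Longrightarrow> (SUP \<theta>\<in>unit_cube. \<Sum>\<xi>\<in>lattice_ball R. ?g (\<xi> + \<theta>)) \<le> C * R powr (?N - s)"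
    using dim n unfolding dim_l1_def less_Sup_iff by (auto simp: ennreal_less_iff)
  \<comment> \<open>The maximum with 0 makes the power increasing, so that \<open>R + n\<close> may be replaced by \<open>(1 + n) R\<close>.\<close>
  define a where "a = max (?N - s) 0"
  have a: "0 \<le> a" "a < 1" using s by (auto simp: a_def)
  show ?thesis
  proof (rule riesz_integral_finite[where a=a and C="\<bar>C\<bar> * (1 + ?N) powr a"])
    fix R :: real assume R: "R \<ge> 1"
    have "(\<integral>\<^sup>+\<eta>. ennreal (?g \<eta>) * indicator (cball 0 R) \<eta> \<partial>lborel)
        \<le> ennreal (SUP \<theta>\<in>unit_cube. \<Sum>\<xi>\<in>lattice_ball (R + ?N). ?g (\<xi> + \<theta>))"
      by (intro ball_integral_le_lattice_sup) (auto intro: norm_fourier_transform_le_1[OF M])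
    also have "\<dots> \<le> ennreal (C * (R + ?N) powr (?N - s))"
      using R by (intro ennreal_leI C) auto
    also have "\<dots> \<le> ennreal (\<bar>C\<bar> * (1 + ?N) powr a * R powr a)"
    proof (rule ennreal_leI)
      have "C * (R + ?N) powr (?N - s) \<le> \<bar>C\<bar> * (R + ?N) powr a"
        using R by (intro mult_mono powr_mono) (auto simp: a_def)
      also have "\<dots> \<le> \<bar>C\<bar> * ((1 + ?N) * R) powr a"
        using R a by (intro mult_left_mono powr_mono2) (auto simp: algebra_simps mult_le_cancel_left1)
      also have "\<dots> = \<bar>C\<bar> * (1 + ?N) powr a * R powr a"
        using R by (simp add: powr_mult)
      finally show "C * (R + ?N) powr (?N - s) \<le> \<bar>C\<bar> * (1 + ?N) powr a * R powr a" .
    qed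
    finally show "(\<integral>\<^sup>+\<eta>. ennreal (?g \<eta>) * indicator (cball 0 R) \<eta> \<partial>lborel) \<le> ennreal (\<bar>C\<bar> * (1 + ?N) powr a * R powr a)" .
  qed (use a n norm_fourier_transform_le_1[OF M] in auto)
qed

section \<open>Lebesgue measure on hyperplanes\<close>

text \<open>Uniqueness of translation invariant measures, with the constant read off from the unit ball \<open>B\<close>: evaluate
  the double integral of \<open>[L y \<in> A] [L y - z \<in> B]\<close> over \<open>y\<close> and \<open>z\<close> in two ways. Integrating over \<open>z\<close> first
  gives the image measure of \<open>A\<close> times \<open>vol B\<close>. Translating \<open>y\<close> first, so that \<open>L y\<close> becomes \<open>L y + z\<close>,
  gives \<open>vol A\<close> times \<open>vol B\<close>, because \<open>L\<close> preserves the ball.\<close>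

lemma lborel_distr_orthogonal:
  fixes L :: "'a::euclidean_space \<Rightarrow> 'a"
  assumes L: "orthogonal_transformation L"
  shows "distr lborel borel L = lborel"
proof (rule measure_eqI)
  have lin: "linear L" using L by (rule orthogonal_transformation_linear)
  have [measurable]: "L \<in> borel_measurable borel"
    using lin by (intro borel_measurable_continuous_onI linear_continuous_on linear_conv_bounded_linear[THEN iffD1])
  let ?B = "cball (0::'a) 1"
  define c where "c = emeasure lborel ?B"
  have [measurable]: "?B \<in> sets borel" by simp
  have c: "c \<noteq> 0" "c \<noteq> \<infinity>"
    unfolding c_def using emeasure_bounded_finite[of ?B]
    by (auto simp: emeasure_cball unit_ball_vol_pos[THEN less_imp_neq, THEN not_sym])
  fix A :: "'a set" assume "A \<in> sets (distr lborel borel L)"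
  then have A [measurable]: "A \<in> sets borel" by simp
  have ball_meas: "(\<integral>\<^sup>+z. indicator ?B (L y - z) \<partial>lborel) = c" for y
  proof -
    have "(\<integral>\<^sup>+z. indicator ?B (L y - z) \<partial>lborel) = (\<integral>\<^sup>+z. indicator ?B (z + - L y) \<partial>lborel)"
      by (intro nn_integral_cong) (simp add: indicator_def norm_minus_commute)
    also have "\<dots> = c"
      unfolding c_def by (subst nn_integral_lborel_translate) auto
    finally show ?thesis .
  qed
  obtain L' where L': "\<And>z. L (L' z) = z"
    using orthogonal_transformation_surj[OF L] by (metis surj_f_inv_f)
  have "emeasure (distr lborel borel L) A * c = (\<integral>\<^sup>+y. indicator A (L y) * (\<integral>\<^sup>+z. indicator ?B (L y - z) \<partial>lborel) \<partial>lborel)"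
    using nn_integral_distr[of L lborel borel "indicator A"] by (simp add: ball_meas nn_integral_multc)
  also have "\<dots> = (\<integral>\<^sup>+y. (\<integral>\<^sup>+z. indicator A (L y) * indicator ?B (L y - z) \<partial>lborel) \<partial>lborel)"
    by (intro nn_integral_cong nn_integral_cmult[symmetric]) measurable
  also have "\<dots> = (\<integral>\<^sup>+z. (\<integral>\<^sup>+y. indicator A (L y) * indicator ?B (L y - z) \<partial>lborel) \<partial>lborel)"
    by (rule lborel_pair.Fubini'[symmetric]) measurable
  also have "\<dots> = (\<integral>\<^sup>+z. (\<integral>\<^sup>+y. indicator A (L y + z) * indicator ?B (L y) \<partial>lborel) \<partial>lborel)"
  proof (rule nn_integral_cong)
    fix z :: 'a
    have "(\<integral>\<^sup>+y. indicator A (L y) * indicator ?B (L y - z) \<partial>lborel)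
        = (\<integral>\<^sup>+y. indicator A (L (y + L' z)) * indicator ?B (L (y + L' z) - z) \<partial>lborel :: ennreal)"
      by (rule nn_integral_lborel_translate[symmetric]) measurable
    then show "(\<integral>\<^sup>+y. indicator A (L y) * indicator ?B (L y - z) \<partial>lborel)
        = (\<integral>\<^sup>+y. indicator A (L y + z) * indicator ?B (L y) \<partial>lborel :: ennreal)"
      by (simp add: linear_add[OF lin] L')
  qed
  also have "\<dots> = (\<integral>\<^sup>+y. (\<integral>\<^sup>+z. indicator A (L y + z) * indicator ?B (L y) \<partial>lborel) \<partial>lborel)"
    by (rule lborel_pair.Fubini') measurable
  also have "\<dots> = (\<integral>\<^sup>+y. emeasure lborel A * indicator ?B y \<partial>lborel)"
  proof (rule nn_integral_cong)
    fix y :: 'a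
    have "(\<integral>\<^sup>+z. indicator A (L y + z) \<partial>lborel) = emeasure lborel A"
      using nn_integral_lborel_translate[of "indicator A" "L y"] by (simp add: add.commute)
    moreover have "indicator ?B (L y) = (indicator ?B y :: ennreal)"
      by (simp add: indicator_def orthogonal_transformation_norm[OF L])
    ultimately show "(\<integral>\<^sup>+z. indicator A (L y + z) * indicator ?B (L y) \<partial>lborel) = emeasure lborel A * indicator ?B y"
      by (simp add: nn_integral_multc)
  qed
  also have "\<dots> = emeasure lborel A * c"
    unfolding c_def by (simp add: nn_integral_cmult)
  finally show "emeasure (distr lborel borel L) A = emeasure lborel A"
    using c by (simp add: ennreal_mult_cancel_left mult.commute[of _ c])
qed simp

text \<open>An orthogonal transformation carries the standard basis to \<open>B\<close>, and it preserves Lebesgue measure.\<close>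

lemma lborel_eq_orthonormal:
  fixes B :: "'a::euclidean_space set"
  assumes orth: "pairwise orthogonal B" and unit: "\<And>b. b \<in> B \<Longrightarrow> norm b = 1"
    and fin: "finite B" and card: "card B = DIM('a)"
  shows "lborel = distr (\<Pi>\<^sub>M b\<in>B. (lborel :: real measure)) borel (\<lambda>f. \<Sum>b\<in>B. f b *\<^sub>R b)"
proof -
  interpret product_sigma_finite "\<lambda>_::'a. lborel :: real measure"
    by standard
  obtain \<pi> where \<pi>: "bij_betw \<pi> (Basis :: 'a set) B"
    using finite_same_card_bij[OF finite_Basis fin] card by metis
  define \<rho> where "\<rho> = inv_into Basis \<pi>"
  have \<pi>B: "\<pi> b \<in> B" if "b \<in> Basis" for b using \<pi> that by (auto simp: bij_betw_def)
  have \<rho>: "bij_betw \<rho> B Basis" unfolding \<rho>_def using \<pi> by (rule bij_betw_inv_into)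
  have \<rho>B: "\<rho> b \<in> Basis" if "b \<in> B" for b using \<rho> that by (auto simp: bij_betw_def)
  have \<rho>\<pi>: "\<rho> (\<pi> b) = b" if "b \<in> Basis" for b
    unfolding \<rho>_def using \<pi> that by (rule bij_betw_inv_into_left)
  define L where "L x = (\<Sum>b\<in>Basis. (x \<bullet> b) *\<^sub>R \<pi> b)" for x :: 'a
  have \<pi>\<pi>: "\<pi> b \<bullet> \<pi> b' = (if b = b' then 1 else 0)" if "b \<in> Basis" "b' \<in> Basis" for b b'
  proof (cases "b = b'")
    case True
    then show ?thesis using unit[OF \<pi>B[OF that(1)]] by (simp add: norm_eq_1)
  next
    case False
    then have "\<pi> b \<noteq> \<pi> b'" using \<rho>\<pi> that by metis
    then show ?thesis using orth \<pi>B that False by (auto simp: pairwise_def orthogonal_def)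
  qed
  have "orthogonal_transformation L"
    unfolding orthogonal_transformation_def
  proof (intro conjI allI)
    show "linear L"
      by (rule linearI) (simp_all add: L_def inner_add_left scaleR_add_left sum.distrib scaleR_sum_right)
    fix v w :: 'a
    have "L v \<bullet> L w = (\<Sum>b\<in>Basis. \<Sum>b'\<in>Basis. (v \<bullet> b) * ((w \<bullet> b') * (\<pi> b \<bullet> \<pi> b')))"
      by (simp add: L_def inner_sum_left inner_sum_right sum_distrib_left, subst sum.swap) (simp add: mult_ac)
    also have "\<dots> = (\<Sum>b\<in>Basis. (v \<bullet> b) * (w \<bullet> b))"
      by (intro sum.cong refl) (simp add: \<pi>\<pi> if_distrib sum.delta cong: if_cong)
    also have "\<dots> = v \<bullet> w" by (rule euclidean_inner[symmetric])
    finally show "L v \<bullet> L w = v \<bullet> w" .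
  qed
  then have "lborel = distr lborel borel L" by (rule lborel_distr_orthogonal[symmetric])
  also have "\<dots> = distr (distr (Pi\<^sub>M Basis (\<lambda>_. lborel)) borel (\<lambda>f. \<Sum>b\<in>Basis. f b *\<^sub>R b)) borel L"
    by (subst lborel_eq) simp
  also have "\<dots> = distr (Pi\<^sub>M Basis (\<lambda>_. lborel)) borel (\<lambda>f. \<Sum>b\<in>Basis. f b *\<^sub>R \<pi> b)"
  proof (subst distr_distr)
    show "L \<in> borel_measurable borel" unfolding L_def by measurable
    have "L (\<Sum>b\<in>Basis. f b *\<^sub>R b) = (\<Sum>b\<in>Basis. f b *\<^sub>R \<pi> b)" for f
      unfolding L_def by (intro sum.cong refl) (simp add: inner_sum_left_Basis)
    then show "distr (Pi\<^sub>M Basis (\<lambda>_. lborel)) borel (L \<circ> (\<lambda>f. \<Sum>b\<in>Basis. f b *\<^sub>R b))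
      = distr (Pi\<^sub>M Basis (\<lambda>_. lborel)) borel (\<lambda>f. \<Sum>b\<in>Basis. f b *\<^sub>R \<pi> b)"
      by (simp add: comp_def)
  qed measurable
  also have "\<dots> = distr (Pi\<^sub>M Basis (\<lambda>_. lborel)) borel ((\<lambda>f. \<Sum>b\<in>B. f b *\<^sub>R b) \<circ> (\<lambda>f. \<lambda>b\<in>B. f (\<rho> b)))"
  proof (rule distr_cong[OF refl refl])
    fix f :: "'a \<Rightarrow> real"
    have "(\<Sum>b\<in>B. f (\<rho> b) *\<^sub>R b) = (\<Sum>b\<in>Basis. f (\<rho> (\<pi> b)) *\<^sub>R \<pi> b)"
      using sum.reindex_bij_betw[OF \<pi>, of "\<lambda>b. f (\<rho> b) *\<^sub>R b"] by simp
    then show "(\<Sum>b\<in>Basis. f b *\<^sub>R \<pi> b) = ((\<lambda>f. \<Sum>b\<in>B. f b *\<^sub>R b) \<circ> (\<lambda>f. \<lambda>b\<in>B. f (\<rho> b))) f"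
      by (simp add: \<rho>\<pi>)
  qed
  also have "\<dots> = distr (distr (Pi\<^sub>M Basis (\<lambda>_. lborel)) (\<Pi>\<^sub>M b\<in>B. lborel) (\<lambda>f. \<lambda>b\<in>B. f (\<rho> b))) borel (\<lambda>f. \<Sum>b\<in>B. f b *\<^sub>R b)"
    using \<rho>B by (subst distr_distr) (auto intro!: measurable_restrict measurable_component_singleton)
  also have "distr (Pi\<^sub>M Basis (\<lambda>_. lborel)) (\<Pi>\<^sub>M b\<in>B. lborel) (\<lambda>f. \<lambda>b\<in>B. f (\<rho> b)) = (\<Pi>\<^sub>M b\<in>B. (lborel :: real measure))"
  proof (rule PiM_eqI[OF fin])
    fix A :: "'a \<Rightarrow> real set" assume A: "\<And>b. b \<in> B \<Longrightarrow> A b \<in> sets lborel"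
    have meas: "(\<lambda>f. \<lambda>b\<in>B. f (\<rho> b)) \<in> measurable (Pi\<^sub>M Basis (\<lambda>_. lborel)) (\<Pi>\<^sub>M b\<in>B. (lborel :: real measure))"
      using \<rho>B by (auto intro!: measurable_restrict measurable_component_singleton)
    have pre: "(\<lambda>f. \<lambda>b\<in>B. f (\<rho> b)) -` (Pi\<^sub>E B A) \<inter> space (Pi\<^sub>M Basis (\<lambda>_. lborel)) = Pi\<^sub>E Basis (\<lambda>b. A (\<pi> b))"
    proof (intro set_eqI iffI)
      fix f assume "f \<in> (\<lambda>f. \<lambda>b\<in>B. f (\<rho> b)) -` (Pi\<^sub>E B A) \<inter> space (Pi\<^sub>M Basis (\<lambda>_. lborel :: real measure))"
      then have f: "f \<in> extensional Basis" "\<And>b. b \<in> B \<Longrightarrow> f (\<rho> b) \<in> A b"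
        by (auto simp: space_PiM PiE_iff)
      show "f \<in> Pi\<^sub>E Basis (\<lambda>b. A (\<pi> b))"
        using f(1) f(2)[OF \<pi>B] \<rho>\<pi> by (auto simp: PiE_iff)
    next
      fix f assume f: "f \<in> Pi\<^sub>E Basis (\<lambda>b. A (\<pi> b))"
      have "\<pi> (\<rho> b) = b" if "b \<in> B" for b
        unfolding \<rho>_def using \<pi> that by (rule bij_betw_inv_into_right)
      then have "f (\<rho> b) \<in> A b" if "b \<in> B" for b
        using f \<rho>B[OF that] that by (metis PiE_mem)
      then show "f \<in> (\<lambda>f. \<lambda>b\<in>B. f (\<rho> b)) -` (Pi\<^sub>E B A) \<inter> space (Pi\<^sub>M Basis (\<lambda>_. lborel :: real measure))"
        using f by (auto simp: space_PiM PiE_iff)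
    qed
    have "emeasure (distr (Pi\<^sub>M Basis (\<lambda>_. lborel)) (\<Pi>\<^sub>M b\<in>B. lborel) (\<lambda>f. \<lambda>b\<in>B. f (\<rho> b))) (Pi\<^sub>E B A)
        = emeasure (Pi\<^sub>M Basis (\<lambda>_. lborel)) (Pi\<^sub>E Basis (\<lambda>b. A (\<pi> b)))"
      using A fin by (subst emeasure_distr[OF meas]) (auto simp: pre intro!: sets_PiM_I_finite)
    also have "\<dots> = (\<Prod>b\<in>Basis. emeasure lborel (A (\<pi> b)))"
      using A \<pi>B by (intro emeasure_PiM) auto
    also have "\<dots> = (\<Prod>b\<in>B. emeasure lborel (A b))"
      by (rule prod.reindex_bij_betw[OF \<pi>])
    finally show "emeasure (distr (Pi\<^sub>M Basis (\<lambda>_. lborel)) (\<Pi>\<^sub>M b\<in>B. lborel) (\<lambda>f. \<lambda>b\<in>B. f (\<rho> b))) (Pi\<^sub>E B A)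
        = (\<Prod>b\<in>B. emeasure lborel (A b))" .
  qed simp
  finally show ?thesis .
qed

lemma closed_normal_hyperplane: "closed (normal_hyperplane \<theta>)"
proof -
  have "normal_hyperplane \<theta> = {x. \<theta> \<bullet> x = 0}"
    by (auto simp: normal_hyperplane_def inner_commute)
  then show ?thesis by (simp add: closed_hyperplane)
qed

lemma orthonormal_basis_of_chosen:
  "orthonormal_basis_of (normal_hyperplane \<theta>) (SOME B. orthonormal_basis_of (normal_hyperplane \<theta>) B)"
proof (rule someI_ex)
  have "subspace (normal_hyperplane \<theta>)"
    by (auto simp: subspace_def normal_hyperplane_def inner_add_left)
  from orthonormal_basis_subspace[OF this]
  show "\<exists>B. orthonormal_basis_of (normal_hyperplane \<theta>) B"
    unfolding orthonormal_basis_of_def by metis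
qed

lemma sets_lborel_subspace [measurable_cong]: "sets (lborel_subspace H) = sets (restrict_space borel H)"
  by (simp add: lborel_subspace_def Let_def)

lemma space_lborel_subspace: "space (lborel_subspace H) = H"
  by (simp add: lborel_subspace_def Let_def space_restrict_space)

text \<open>Adding \<open>\<theta>\<close> to the orthonormal basis that defines the measure on the hyperplane gives an orthonormal basis of
  the whole space, and \<open>\<theta>\<close> is the coordinate integrated separately.\<close>

lemma nn_integral_lborel_hyperplane_fibres:
  fixes \<theta> :: "'a::euclidean_space" and \<phi> :: "'a \<Rightarrow> ennreal"
  assumes \<theta>: "norm \<theta> = 1" and [measurable]: "\<phi> \<in> borel_measurable borel"
  shows "(\<integral>\<^sup>+x. \<phi> x \<partial>lborel)
       = (\<integral>\<^sup>+h. (\<integral>\<^sup>+t. \<phi> (h + t *\<^sub>R \<theta>) \<partial>lborel) \<partial>lborel_subspace (normal_hyperplane \<theta>))"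
proof -
  interpret product_sigma_finite "\<lambda>_::'a. lborel :: real measure"
    by standard
  let ?H = "normal_hyperplane \<theta>"
  define B where "B = (SOME B. orthonormal_basis_of ?H B)"
  have "orthonormal_basis_of ?H B" unfolding B_def by (rule orthonormal_basis_of_chosen)
  then have B: "B \<subseteq> ?H" "pairwise orthogonal B" "\<And>b. b \<in> B \<Longrightarrow> norm b = 1" "span B = ?H"
    by (auto simp: orthonormal_basis_of_def)
  have perp: "b \<bullet> \<theta> = 0" if "b \<in> B" for b using B(1) that by (auto simp: normal_hyperplane_def)
  have fin: "finite B" using pairwise_orthogonal_imp_finite[OF B(2)] .
  have \<theta>\<theta>: "\<theta> \<bullet> \<theta> = 1" using \<theta> by (simp add: norm_eq_1)
  have \<theta>B: "\<theta> \<notin> B" using perp \<theta>\<theta> by fastforce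
  have orth: "pairwise orthogonal (insert \<theta> B)"
    using B(2) perp by (auto simp: pairwise_insert orthogonal_def inner_commute)
  have unit: "norm b = 1" if "b \<in> insert \<theta> B" for b using that B(3) \<theta> by auto
  have "independent (insert \<theta> B)"
    using orth unit[of 0] by (intro pairwise_orthogonal_independent) auto
  moreover have "span (insert \<theta> B) = UNIV"
  proof -
    have "x \<in> span (insert \<theta> B)" for x
    proof -
      have "x - (x \<bullet> \<theta>) *\<^sub>R \<theta> \<in> ?H" by (simp add: normal_hyperplane_def inner_diff_left \<theta>\<theta>)
      then have "x - (x \<bullet> \<theta>) *\<^sub>R \<theta> \<in> span B" using B(4) by simp
      then show ?thesis unfolding span_insert by blast
    qed
    then show ?thesis by auto
  qed
  ultimately have "card (insert \<theta> B) = DIM('a)"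
    by (metis dim_UNIV dim_span_eq_card_independent)
  then have lb: "lborel = distr (\<Pi>\<^sub>M b\<in>insert \<theta> B. (lborel :: real measure)) borel (\<lambda>f. \<Sum>b\<in>insert \<theta> B. f b *\<^sub>R b)"
    using fin by (intro lborel_eq_orthonormal[OF orth unit]) auto
  have "(\<integral>\<^sup>+x. \<phi> x \<partial>lborel) = (\<integral>\<^sup>+f. \<phi> (\<Sum>b\<in>insert \<theta> B. f b *\<^sub>R b) \<partial>(\<Pi>\<^sub>M b\<in>insert \<theta> B. lborel))"
    by (subst lb, subst nn_integral_distr) auto
  also have "\<dots> = (\<integral>\<^sup>+f. (\<integral>\<^sup>+t. \<phi> (\<Sum>b\<in>insert \<theta> B. (f(\<theta> := t)) b *\<^sub>R b) \<partial>lborel) \<partial>(\<Pi>\<^sub>M b\<in>B. lborel))"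
    using fin \<theta>B by (intro product_nn_integral_insert) auto
  also have "\<dots> = (\<integral>\<^sup>+f. (\<integral>\<^sup>+t. \<phi> ((\<Sum>b\<in>B. f b *\<^sub>R b) + t *\<^sub>R \<theta>) \<partial>lborel) \<partial>(\<Pi>\<^sub>M b\<in>B. lborel))"
  proof -
    have "(\<Sum>b\<in>insert \<theta> B. (f(\<theta> := t)) b *\<^sub>R b) = (\<Sum>b\<in>B. f b *\<^sub>R b) + t *\<^sub>R \<theta>" for f t
    proof -
      have "(\<Sum>b\<in>B. (f(\<theta> := t)) b *\<^sub>R b) = (\<Sum>b\<in>B. f b *\<^sub>R b)"
        using \<theta>B by (intro sum.cong) auto
      then show ?thesis using fin \<theta>B by (simp add: add.commute del: fun_upd_apply) simp
    qed
    then show ?thesis by simp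
  qed
  also have "\<dots> = (\<integral>\<^sup>+h. (\<integral>\<^sup>+t. \<phi> (h + t *\<^sub>R \<theta>) \<partial>lborel) \<partial>lborel_subspace ?H)"
  proof -
    have "(\<lambda>f. \<Sum>b\<in>B. f b *\<^sub>R b) \<in> measurable (\<Pi>\<^sub>M b\<in>B. (lborel :: real measure)) (restrict_space borel ?H)"
    proof (rule measurable_restrict_space2)
      have "(\<Sum>b\<in>B. f b *\<^sub>R b) \<in> ?H" for f
        unfolding B(4)[symmetric] by (intro span_sum span_scale span_base)
      then show "(\<lambda>f. \<Sum>b\<in>B. f b *\<^sub>R b) \<in> space (\<Pi>\<^sub>M b\<in>B. (lborel :: real measure)) \<rightarrow> ?H" by auto
    qed measurable
    moreover have "(\<lambda>h. \<integral>\<^sup>+t. \<phi> (h + t *\<^sub>R \<theta>) \<partial>lborel) \<in> borel_measurable (restrict_space borel ?H)"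
      by (intro measurable_restrict_space1) measurable
    ultimately show ?thesis
      unfolding lborel_subspace_def Let_def B_def[symmetric] by (subst nn_integral_distr) auto
  qed
  finally show ?thesis .
qed

section \<open>The density of a projection\<close>

lemma proj_along_unit:
  fixes \<theta> :: "'a::euclidean_space"
  assumes "norm \<theta> = 1"
  shows "proj_along \<theta> y = y - (y \<bullet> \<theta>) *\<^sub>R \<theta>"
  unfolding proj_along_def
proof (rule the_equality)
  have \<theta>\<theta>: "\<theta> \<bullet> \<theta> = 1" using assms by (simp add: norm_eq_1)
  show "y - (y \<bullet> \<theta>) *\<^sub>R \<theta> \<in> normal_hyperplane \<theta> \<and> (\<exists>t. y = y - (y \<bullet> \<theta>) *\<^sub>R \<theta> + t *\<^sub>R \<theta>)"
    by (auto simp: normal_hyperplane_def inner_diff_left \<theta>\<theta>)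
  fix h assume "h \<in> normal_hyperplane \<theta> \<and> (\<exists>t. y = h + t *\<^sub>R \<theta>)"
  then show "h = y - (y \<bullet> \<theta>) *\<^sub>R \<theta>"
    by (auto simp: normal_hyperplane_def inner_add_left \<theta>\<theta>)
qed

definition gauss_measure :: "real measure" where
  "gauss_measure = density lborel (\<lambda>u. ennreal (exp (- pi * u\<^sup>2)))"

lemma sets_gauss_measure [measurable_cong, simp]: "sets gauss_measure = sets borel"
  by (simp add: gauss_measure_def)

lemma prob_space_gauss_measure: "prob_space gauss_measure"
proof
  have "emeasure gauss_measure (space gauss_measure) = (\<integral>\<^sup>+u. ennreal (gauss_kernel 1 (u::real)) \<partial>lborel)"
    by (simp add: gauss_measure_def emeasure_density gauss_kernel_def)
  then show "emeasure gauss_measure (space gauss_measure) = 1"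
    by (simp add: gauss_kernel_prob)
qed

lemma fourier_transform_gauss_measure: "fourier_transform gauss_measure s = exp (- pi * s\<^sup>2)"
proof -
  have "fourier_transform gauss_measure s = (\<integral>u. cis (2 * pi * ((- s) * u)) * exp (- pi * 1\<^sup>2 * u\<^sup>2) \<partial>lborel)"
    unfolding fourier_transform_cis gauss_measure_def
    by (subst integral_density) (auto simp: scaleR_conv_of_real mult_ac)
  also have "\<dots> = exp (- pi * s\<^sup>2)"
    using has_bochner_integral_integral_eq[OF has_bochner_integral_gaussian_fourier_real[of 1 "- s"]] by simp
  finally show ?thesis .
qed

text \<open>Move each point \<open>y\<close> along its line \<open>y + \<real> \<theta>\<close> to the point whose \<open>k\<close>-th coordinate is an independent
  Gaussian \<open>u\<close>. This does not change the projection along \<open>\<theta>\<close>, and it makes the \<open>k\<close>-th coordinate independent of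
  that projection.\<close>

definition smeared_measure :: "'a::euclidean_space \<Rightarrow> 'a \<Rightarrow> 'a measure \<Rightarrow> 'a measure" where
  "smeared_measure k \<theta> M =
     distr (M \<Otimes>\<^sub>M gauss_measure) borel (\<lambda>(y, u). y + ((u - y \<bullet> k) / (\<theta> \<bullet> k)) *\<^sub>R \<theta>)"

context
  fixes M :: "'a::euclidean_space measure" and k \<theta> :: 'a
  assumes M: "prob_space M" and sets_M [measurable_cong]: "sets M = sets borel"
    and \<theta>: "norm \<theta> = 1" and \<theta>k: "\<theta> \<bullet> k \<noteq> 0"
begin

interpretation pair_prob_space M gauss_measure
  using M prob_space_gauss_measure by (simp add: pair_prob_space_def pair_sigma_finite_def prob_space_imp_sigma_finite)

lemma prob_space_smeared: "prob_space (smeared_measure k \<theta> M)"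
  unfolding smeared_measure_def by (rule prob_space_distr) measurable

text \<open>The phase \<open>(y + ((u - y \<bullet> k) / (\<theta> \<bullet> k)) \<theta>) \<bullet> \<eta>\<close> equals \<open>y \<bullet> (\<eta> - s k) + u s\<close> with
  \<open>s = (\<eta> \<bullet> \<theta>) / (\<theta> \<bullet> k)\<close>, so the transform factors. The frequency \<open>\<eta> - s k\<close> is orthogonal to \<open>\<theta>\<close>: only
  the restriction of the transform of \<open>M\<close> to the hyperplane enters.\<close>

lemma fourier_transform_smeared:
  "fourier_transform (smeared_measure k \<theta> M) \<eta> =
     fourier_transform M (\<eta> - ((\<eta> \<bullet> \<theta>) / (\<theta> \<bullet> k)) *\<^sub>R k) * exp (- pi * ((\<eta> \<bullet> \<theta>) / (\<theta> \<bullet> k))\<^sup>2)"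
proof -
  define s where "s = (\<eta> \<bullet> \<theta>) / (\<theta> \<bullet> k)"
  have inn: "(y + ((u - y \<bullet> k) / (\<theta> \<bullet> k)) *\<^sub>R \<theta>) \<bullet> \<eta> = y \<bullet> (\<eta> - s *\<^sub>R k) + u * s" for y u
    by (simp add: s_def inner_add_left inner_diff_right inner_commute[of \<theta> \<eta>] diff_divide_distrib algebra_simps)
  have phase: "cis (- (2 * pi * ((y + ((u - y \<bullet> k) / (\<theta> \<bullet> k)) *\<^sub>R \<theta>) \<bullet> \<eta>)))
      = cis (- (2 * pi * (y \<bullet> (\<eta> - s *\<^sub>R k)))) * cis (- (2 * pi * (u * s)))" for y u
    by (simp only: inn cis_mult distrib_left minus_add_distrib)
  have "fourier_transform (smeared_measure k \<theta> M) \<eta>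
      = (\<integral>(y, u). cis (- (2 * pi * (y \<bullet> (\<eta> - s *\<^sub>R k)))) * cis (- (2 * pi * (u * s))) \<partial>(M \<Otimes>\<^sub>M gauss_measure))"
    unfolding fourier_transform_cis smeared_measure_def
    by (subst integral_distr) (auto simp: phase split_def)
  also have "\<dots> = (\<integral>y. (\<integral>u. cis (- (2 * pi * (y \<bullet> (\<eta> - s *\<^sub>R k)))) * cis (- (2 * pi * (u * s))) \<partial>gauss_measure) \<partial>M)"
  proof (subst integral_fst'[symmetric])
    show "integrable (M \<Otimes>\<^sub>M gauss_measure) (\<lambda>(y, u). cis (- (2 * pi * (y \<bullet> (\<eta> - s *\<^sub>R k)))) * cis (- (2 * pi * (u * s))))"
      by (rule P.integrable_const_bound[where B=1]) (auto simp: norm_mult split_def)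
  qed simp
  also have "\<dots> = (\<integral>y. cis (- (2 * pi * (y \<bullet> (\<eta> - s *\<^sub>R k)))) * fourier_transform gauss_measure s \<partial>M)"
    unfolding fourier_transform_cis by simp
  also have "\<dots> = fourier_transform M (\<eta> - s *\<^sub>R k) * exp (- pi * s\<^sup>2)"
    unfolding fourier_transform_gauss_measure unfolding fourier_transform_cis by (rule integral_mult_left_zero)
  finally show ?thesis by (simp add: s_def)
qed

lemma slab_emeasure_smeared:
  assumes A: "A \<in> sets borel" and I [measurable]: "I \<in> sets borel"
  shows "emeasure (smeared_measure k \<theta> M) {z. z - (z \<bullet> \<theta>) *\<^sub>R \<theta> \<in> A \<and> z \<bullet> k \<in> I}
    = emeasure M {y. y - (y \<bullet> \<theta>) *\<^sub>R \<theta> \<in> A} * emeasure gauss_measure I"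
proof -
  note [measurable] = A
  have \<theta>\<theta>: "\<theta> \<bullet> \<theta> = 1" using \<theta> by (simp add: norm_eq_1)
  have UNIV_M: "space M = UNIV" using sets_M by (metis sets_eq_imp_space_eq space_borel)
  have UNIV_g: "space gauss_measure = UNIV" by (simp add: gauss_measure_def)
  let ?\<Phi> = "\<lambda>(y, u). y + ((u - y \<bullet> k) / (\<theta> \<bullet> k)) *\<^sub>R \<theta>"
  have \<Phi>_perp: "(y + t *\<^sub>R \<theta>) - ((y + t *\<^sub>R \<theta>) \<bullet> \<theta>) *\<^sub>R \<theta> = y - (y \<bullet> \<theta>) *\<^sub>R \<theta>" for y t
    by (simp add: inner_add_left \<theta>\<theta> algebra_simps)
  have \<Phi>_k: "(y + ((u - y \<bullet> k) / (\<theta> \<bullet> k)) *\<^sub>R \<theta>) \<bullet> k = u" for y u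
    using \<theta>k by (simp add: inner_add_left)
  have pre: "?\<Phi> -` {z. z - (z \<bullet> \<theta>) *\<^sub>R \<theta> \<in> A \<and> z \<bullet> k \<in> I} \<inter> space (M \<Otimes>\<^sub>M gauss_measure)
      = {y. y - (y \<bullet> \<theta>) *\<^sub>R \<theta> \<in> A} \<times> I"
    by (simp only: set_eq_iff Int_iff vimage_eq mem_Collect_eq mem_Times_iff split_def \<Phi>_perp \<Phi>_k
        space_pair_measure UNIV_M UNIV_g UNIV_Times_UNIV UNIV_I simp_thms)
  have "emeasure (smeared_measure k \<theta> M) {z. z - (z \<bullet> \<theta>) *\<^sub>R \<theta> \<in> A \<and> z \<bullet> k \<in> I}
      = emeasure (M \<Otimes>\<^sub>M gauss_measure) ({y. y - (y \<bullet> \<theta>) *\<^sub>R \<theta> \<in> A} \<times> I)"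
    unfolding smeared_measure_def pre[symmetric] by (rule emeasure_distr) measurable
  also have "\<dots> = emeasure M {y. y - (y \<bullet> \<theta>) *\<^sub>R \<theta> \<in> A} * emeasure gauss_measure I"
  proof (rule M2.emeasure_pair_measure_Times)
    have "{y. y - (y \<bullet> \<theta>) *\<^sub>R \<theta> \<in> A} \<in> sets borel" by measurable
    then show "{y. y - (y \<bullet> \<theta>) *\<^sub>R \<theta> \<in> A} \<in> sets M" by (simp add: sets_M)
  qed simp
  finally show ?thesis .
qed

text \<open>By the hypothesis the smeared measure has an integrable transform, hence a continuous density \<open>F\<close>. Since the
  Gaussian coordinate is independent of the projection, the projected measure of \<open>A\<close> is proportional to the
  smeared measure of the part of the slab \<open>0 \<le> z \<bullet> k \<le> 1\<close> over \<open>A\<close>. The slab meets every line parallel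
  to \<open>\<theta>\<close> in a compact segment, so the resulting density, the integral of \<open>F\<close> over that segment, is
  continuous.\<close>

lemma projection_continuous_density:
  assumes fin: "(\<integral>\<^sup>+\<eta>. ennreal (cmod (fourier_transform M (\<eta> - ((\<eta> \<bullet> \<theta>) / (\<theta> \<bullet> k)) *\<^sub>R k)))
      * ennreal (exp (- pi * ((\<eta> \<bullet> \<theta>) / (\<theta> \<bullet> k))\<^sup>2)) \<partial>lborel) < \<infinity>"
  shows "\<exists>f. continuous_on UNIV f \<and> (\<forall>x. 0 \<le> f x) \<and>
    pushforward_proj \<theta> M = density (lborel_subspace (normal_hyperplane \<theta>)) (\<lambda>x. ennreal (f x))"
proof -
  let ?\<nu> = "smeared_measure k \<theta> M" and ?H = "normal_hyperplane \<theta>"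
  have \<theta>\<theta>: "\<theta> \<bullet> \<theta> = 1" using \<theta> by (simp add: norm_eq_1)
  have sets_\<nu>: "sets ?\<nu> = sets borel" by (simp add: smeared_measure_def)
  have UNIV_M: "space M = UNIV" using sets_M by (metis sets_eq_imp_space_eq space_borel)
  have "integrable lborel (fourier_transform ?\<nu>)"
  proof (rule integrableI_bounded)
    have "fourier_transform ?\<nu> \<in> borel_measurable borel"
      by (rule fourier_transform_measurable[OF prob_space.finite_measure[OF prob_space_smeared] sets_\<nu>])
    then show "fourier_transform ?\<nu> \<in> borel_measurable lborel" by simp
    show "(\<integral>\<^sup>+\<eta>. ennreal (norm (fourier_transform ?\<nu> \<eta>)) \<partial>lborel) < \<infinity>"
      using fin by (simp add: fourier_transform_smeared norm_mult ennreal_mult)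
  qed
  from fourier_inversion[OF prob_space_smeared sets_\<nu> this]
  obtain F :: "'a \<Rightarrow> real" where F: "continuous_on UNIV F" "\<And>x. 0 \<le> F x"
    "?\<nu> = density lborel (\<lambda>x. ennreal (F x))" by blast
  have [measurable]: "F \<in> borel_measurable borel" using F(1) by (rule borel_measurable_continuous_onI)
  define c where "c = measure gauss_measure {0..1}"
  have c_em: "emeasure gauss_measure {0..1} = ennreal c"
    unfolding c_def by (rule M2.emeasure_eq_measure)
  have c: "c > 0"
  proof -
    have "ennreal (exp (- pi)) = (\<integral>\<^sup>+u. ennreal (exp (- pi)) * indicator {0..1::real} u \<partial>lborel)"
      by (simp add: nn_integral_cmult)
    also have "\<dots> \<le> (\<integral>\<^sup>+u. ennreal (exp (- pi * u\<^sup>2)) * indicator {0..1::real} u \<partial>lborel)"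
      by (intro nn_integral_mono) (auto simp: indicator_def abs_square_le_1 intro!: ennreal_leI)
    also have "\<dots> = ennreal c"
      by (simp add: c_em[symmetric] gauss_measure_def emeasure_density)
    finally have le: "ennreal (exp (- pi)) \<le> ennreal c" .
    show ?thesis
    proof (rule ccontr)
      assume "\<not> c > 0"
      then have "ennreal c = 0" by (simp add: ennreal_neg)
      then show False using le by simp
    qed
  qed
  \<comment> \<open>\<open>\<psi> h\<close> is \<open>F\<close> along the line \<open>h + \<real> \<theta>\<close>, parametrised by the \<open>k\<close>-th coordinate \<open>u\<close>; this turns all the segments into the same interval \<open>{0..1}\<close>.\<close>
  define \<psi> where "\<psi> h u = F (h + ((u - h \<bullet> k) / (\<theta> \<bullet> k)) *\<^sub>R \<theta>)" for h u
  define f where "f h = integral (cbox 0 1) (\<psi> h) / (c * \<bar>\<theta> \<bullet> k\<bar>)" for h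
  have \<psi>c: "continuous_on (UNIV \<times> cbox 0 1) (\<lambda>(h, u). \<psi> h u)"
    unfolding \<psi>_def split_def using \<theta>k
    by (intro continuous_on_compose2[OF F(1)] continuous_intros) auto
  have f_cont: "continuous_on UNIV f"
    unfolding f_def using c \<theta>k by (intro continuous_intros integral_continuous_on_param[OF \<psi>c]) auto
  then have [measurable]: "f \<in> borel_measurable borel" by (rule borel_measurable_continuous_onI)
  have \<psi>_int: "\<psi> h integrable_on cbox 0 1" for h
    unfolding \<psi>_def using \<theta>k
    by (intro integrable_continuous continuous_on_compose2[OF F(1)] continuous_intros) auto
  have f_nonneg: "0 \<le> f h" for h
    unfolding f_def using c F(2) \<psi>_int
    by (intro divide_nonneg_nonneg integral_nonneg) (auto simp: \<psi>_def)
  have fibre: "(\<integral>\<^sup>+t. ennreal (F (h + t *\<^sub>R \<theta>)) * indicator {0..1} ((h + t *\<^sub>R \<theta>) \<bullet> k) \<partial>lborel) = ennreal (c * f h)" for h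
  proof -
    have cnz: "1 / (\<theta> \<bullet> k) \<noteq> 0" using \<theta>k by simp
    have arg: "- (h \<bullet> k) / (\<theta> \<bullet> k) + 1 / (\<theta> \<bullet> k) * u = (u - h \<bullet> k) / (\<theta> \<bullet> k)" for u
      by (simp add: diff_divide_distrib)
    have "(\<integral>\<^sup>+t. ennreal (F (h + t *\<^sub>R \<theta>)) * indicator {0..1} ((h + t *\<^sub>R \<theta>) \<bullet> k) \<partial>lborel)
        = ennreal \<bar>1 / (\<theta> \<bullet> k)\<bar> * (\<integral>\<^sup>+u. ennreal (\<psi> h u) * indicator {0..1} u \<partial>lborel)"
    proof (subst nn_integral_real_affine[OF _ cnz, of _ "- (h \<bullet> k) / (\<theta> \<bullet> k)"])
      show "ennreal \<bar>1 / (\<theta> \<bullet> k)\<bar> * (\<integral>\<^sup>+u. ennreal (F (h + (- (h \<bullet> k) / (\<theta> \<bullet> k) + 1 / (\<theta> \<bullet> k) * u) *\<^sub>R \<theta>))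
           * indicator {0..1} ((h + (- (h \<bullet> k) / (\<theta> \<bullet> k) + 1 / (\<theta> \<bullet> k) * u) *\<^sub>R \<theta>) \<bullet> k) \<partial>lborel)
         = ennreal \<bar>1 / (\<theta> \<bullet> k)\<bar> * (\<integral>\<^sup>+u. ennreal (\<psi> h u) * indicator {0..1} u \<partial>lborel)"
        unfolding arg \<psi>_def using \<theta>k by (simp add: inner_add_left)
    qed measurable
    also have "(\<integral>\<^sup>+u. ennreal (\<psi> h u) * indicator {0..1} u \<partial>lborel) = ennreal (integral (cbox 0 1) (\<psi> h))"
      using nn_integral_has_integral_lebesgue'[of "cbox 0 1" "\<psi> h" "integral (cbox 0 1) (\<psi> h)"] \<psi>_int F(2)
      by (auto simp: \<psi>_def integrable_integral)
    also have "ennreal \<bar>1 / (\<theta> \<bullet> k)\<bar> * \<dots> = ennreal (\<bar>1 / (\<theta> \<bullet> k)\<bar> * integral (cbox 0 1) (\<psi> h))"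
      by (rule ennreal_mult[symmetric]) (use F(2) \<psi>_int in \<open>auto simp: \<psi>_def intro!: integral_nonneg\<close>)
    also have "\<bar>1 / (\<theta> \<bullet> k)\<bar> * integral (cbox 0 1) (\<psi> h) = c * f h"
      using c \<theta>k by (simp add: f_def field_simps)
    finally show ?thesis .
  qed
  have proj: "proj_along \<theta> = (\<lambda>y. y - (y \<bullet> \<theta>) *\<^sub>R \<theta>)"
    using proj_along_unit[OF \<theta>] by auto
  have in_H: "y - (y \<bullet> \<theta>) *\<^sub>R \<theta> \<in> ?H" for y
    by (simp add: normal_hyperplane_def inner_diff_left \<theta>\<theta>)
  have "pushforward_proj \<theta> M = density (lborel_subspace ?H) (\<lambda>x. ennreal (f x))"
  proof (rule measure_eqI)
    show "sets (pushforward_proj \<theta> M) = sets (density (lborel_subspace ?H) (\<lambda>x. ennreal (f x)))"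
      by (simp add: pushforward_proj_def sets_lborel_subspace)
    fix A assume "A \<in> sets (pushforward_proj \<theta> M)"
    then have AH: "A \<in> sets (restrict_space borel ?H)" by (simp add: pushforward_proj_def)
    then have [measurable]: "A \<in> sets borel" and AsubH: "A \<subseteq> ?H"
      using closed_normal_hyperplane[of \<theta>] by (auto simp: sets_restrict_space_iff)
    have mf: "(\<lambda>x. ennreal (f x)) \<in> borel_measurable (lborel_subspace ?H)"
      by (subst measurable_cong_sets[OF sets_lborel_subspace refl]) (intro measurable_restrict_space1, measurable)
    have mA: "indicator A \<in> borel_measurable (lborel_subspace ?H)"
      using AH by (intro borel_measurable_indicator) (simp add: sets_lborel_subspace)
    have "proj_along \<theta> \<in> measurable M (restrict_space borel ?H)"
      unfolding proj by (rule measurable_restrict_space2) (use in_H in auto)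
    then have push: "emeasure (pushforward_proj \<theta> M) A = emeasure M {y. y - (y \<bullet> \<theta>) *\<^sub>R \<theta> \<in> A}"
      unfolding pushforward_proj_def using AH by (subst emeasure_distr) (auto simp: proj UNIV_M vimage_def)
    have "ennreal c * emeasure (pushforward_proj \<theta> M) A = emeasure ?\<nu> {z. z - (z \<bullet> \<theta>) *\<^sub>R \<theta> \<in> A \<and> z \<bullet> k \<in> {0..1}}"
      unfolding push by (subst slab_emeasure_smeared) (auto simp: c_em mult.commute)
    also have "\<dots> = (\<integral>\<^sup>+z. ennreal (F z) * indicator {z. z - (z \<bullet> \<theta>) *\<^sub>R \<theta> \<in> A \<and> z \<bullet> k \<in> {0..1}} z \<partial>lborel)"
      unfolding F(3) by (rule emeasure_density) measurable
    also have "\<dots> = (\<integral>\<^sup>+h. (\<integral>\<^sup>+t. ennreal (F (h + t *\<^sub>R \<theta>))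
        * indicator {z. z - (z \<bullet> \<theta>) *\<^sub>R \<theta> \<in> A \<and> z \<bullet> k \<in> {0..1}} (h + t *\<^sub>R \<theta>) \<partial>lborel) \<partial>lborel_subspace ?H)"
      by (rule nn_integral_lborel_hyperplane_fibres[OF \<theta>]) measurable
    also have "\<dots> = (\<integral>\<^sup>+h. ennreal c * (ennreal (f h) * indicator A h) \<partial>lborel_subspace ?H)"
    proof (rule nn_integral_cong)
      fix h assume "h \<in> space (lborel_subspace ?H)"
      then have "h \<bullet> \<theta> = 0" by (simp add: space_lborel_subspace normal_hyperplane_def)
      then have perp: "(h + t *\<^sub>R \<theta>) - ((h + t *\<^sub>R \<theta>) \<bullet> \<theta>) *\<^sub>R \<theta> = h" for t
        by (simp add: inner_add_left \<theta>\<theta>)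
      have "ennreal (F (h + t *\<^sub>R \<theta>)) * indicator {z. z - (z \<bullet> \<theta>) *\<^sub>R \<theta> \<in> A \<and> z \<bullet> k \<in> {0..1}} (h + t *\<^sub>R \<theta>)
          = ennreal (F (h + t *\<^sub>R \<theta>)) * indicator {0..1} ((h + t *\<^sub>R \<theta>) \<bullet> k) * indicator A h" for t
        by (simp only: indicator_def mem_Collect_eq perp) auto
      then have "(\<integral>\<^sup>+t. ennreal (F (h + t *\<^sub>R \<theta>)) * indicator {z. z - (z \<bullet> \<theta>) *\<^sub>R \<theta> \<in> A \<and> z \<bullet> k \<in> {0..1}} (h + t *\<^sub>R \<theta>) \<partial>lborel)
          = (\<integral>\<^sup>+t. ennreal (F (h + t *\<^sub>R \<theta>)) * indicator {0..1} ((h + t *\<^sub>R \<theta>) \<bullet> k) \<partial>lborel) * indicator A h"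
        by (simp only:) (rule nn_integral_multc, measurable)
      then show "(\<integral>\<^sup>+t. ennreal (F (h + t *\<^sub>R \<theta>)) * indicator {z. z - (z \<bullet> \<theta>) *\<^sub>R \<theta> \<in> A \<and> z \<bullet> k \<in> {0..1}} (h + t *\<^sub>R \<theta>) \<partial>lborel)
          = ennreal c * (ennreal (f h) * indicator A h)"
        unfolding fibre using c f_nonneg by (simp add: ennreal_mult mult.assoc)
    qed
    also have "\<dots> = ennreal c * (\<integral>\<^sup>+h. ennreal (f h) * indicator A h \<partial>lborel_subspace ?H)"
      using mf mA by (intro nn_integral_cmult borel_measurable_times_ennreal)
    also have "\<dots> = ennreal c * emeasure (density (lborel_subspace ?H) (\<lambda>x. ennreal (f x))) A"
      using mf AH by (subst emeasure_density) (auto simp: sets_lborel_subspace)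
    finally show "emeasure (pushforward_proj \<theta> M) A = emeasure (density (lborel_subspace ?H) (\<lambda>x. ennreal (f x))) A"
      using c by (simp add: ennreal_mult_cancel_left)
  qed
  then show ?thesis using f_cont f_nonneg by blast
qed

end

section \<open>Almost every direction\<close>

text \<open>The surface measure is a multiple of the image of Lebesgue measure on the punctured ball under radial projection.\<close>

lemma AE_sphere_measure_radial:
  fixes Q :: "'a::euclidean_space \<Rightarrow> bool"
  assumes [measurable]: "Measurable.pred borel Q" and ae: "AE x in lborel. Q (x /\<^sub>R norm x)"
  shows "AE \<theta> in sphere_measure. Q \<theta>"
proof -
  let ?S = "restrict_space borel (sphere (0::'a) 1)" and ?P = "restrict_space lborel (ball (0::'a) 1 - {0})"
  let ?D = "distr ?P ?S (\<lambda>x. x /\<^sub>R norm x)"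
  have map: "(\<lambda>x. x /\<^sub>R norm x) \<in> measurable ?P ?S"
    by (rule measurable_restrict_space2) (auto simp: space_restrict_space intro!: measurable_restrict_space1)
  have Q: "{\<theta> \<in> space ?S. Q \<theta>} \<in> sets ?S"
    using measurable_restrict_space1[OF assms(1), of "sphere 0 1"] by measurable
  have aeD: "AE \<theta> in ?D. Q \<theta>"
    unfolding AE_distr_iff[OF map Q]
    using ae by (subst AE_restrict_space_iff) auto
  have "emeasure ?D {\<theta> \<in> space ?S. \<not> Q \<theta>} = 0"
    using AE_E2[OF aeD] Q by simp
  then have "{\<theta> \<in> space ?S. \<not> Q \<theta>} \<in> null_sets ?D"
    using sets.sets_Collect_neg[OF Q] by (intro null_setsI) auto
  then have "{\<theta> \<in> space ?S. \<not> Q \<theta>} \<in> null_sets (sphere_measure :: 'a measure)"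
    by (simp add: null_sets_def sphere_measure_def)
  then show ?thesis
    by (rule AE_I') (auto simp: sphere_measure_def space_scale_measure)
qed

lemma AE_sphere_measure_in_sphere: "AE \<theta> in sphere_measure. norm (\<theta>::'a::euclidean_space) = 1"
  by (rule AE_I2) (simp add: sphere_measure_def space_scale_measure space_restrict_space)

theorem theorem2p3:
  fixes M :: "(real ^ 'n) measure"
  assumes "CARD('n) \<ge> 2"
    and "prob_space M"
    and "sets M = sets borel"
    and "compact (support_of M)"
    and "dim_l1 M > ennreal (real CARD('n) - 1)"
  shows "AE \<theta> in (sphere_measure :: (real ^ 'n) measure).
           absolutely_continuous (lborel_subspace (normal_hyperplane \<theta>)) (pushforward_proj \<theta> M) \<and>
           (\<exists>f :: real ^ 'n \<Rightarrow> real.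
              continuous_on (normal_hyperplane \<theta>) f \<and>
              (\<forall>x\<in>normal_hyperplane \<theta>. f x \<ge> 0) \<and>
              pushforward_proj \<theta> M =
                density (lborel_subspace (normal_hyperplane \<theta>)) (\<lambda>x. ennreal (f x)))"
proof -
  obtain k :: "real ^ 'n" where k: "k \<in> Basis" using nonempty_Basis by blast
  define J where "J x = (\<integral>\<^sup>+\<eta>. ennreal (cmod (fourier_transform M (\<eta> - ((\<eta> \<bullet> x) / (x \<bullet> k)) *\<^sub>R k)))
      * ennreal (exp (- pi * ((\<eta> \<bullet> x) / (x \<bullet> k))\<^sup>2)) \<partial>lborel)" for x
  have [measurable]: "fourier_transform M \<in> borel_measurable borel"
    using assms(2,3) by (intro fourier_transform_measurable prob_space.finite_measure)
  have [measurable]: "J \<in> borel_measurable borel" unfolding J_def by measurable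
  have "(\<integral>\<^sup>+s. ennreal (exp (- pi * s\<^sup>2)) \<partial>lborel) = 1"
    using gauss_kernel_prob[of 1, where 'a=real] by (simp add: gauss_kernel_def)
  then have AE_J: "AE x in lborel. J x < \<infinity>"
    unfolding J_def using assms(1) fourier_energy_finite[OF assms(1,2,3,5)]
    by (intro AE_hyperplane_integral_finite[OF _ _ k]) auto
  \<comment> \<open>\<open>J x\<close> depends only on the direction of \<open>x\<close>, so finiteness almost everywhere in space gives it almost everywhere on the sphere.\<close>
  have J_radial: "J (x /\<^sub>R norm x) = J x" if "x \<noteq> 0" for x
    using that by (simp add: J_def)
  have "AE \<theta> in sphere_measure. J \<theta> < \<infinity> \<and> \<theta> \<bullet> k \<noteq> 0"
  proof (rule AE_sphere_measure_radial)
    show "AE x in lborel. J (x /\<^sub>R norm x) < \<infinity> \<and> (x /\<^sub>R norm x) \<bullet> k \<noteq> 0"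
      using AE_J AE_coordinate_nonzero[OF k]
    proof eventually_elim
      case (elim x)
      then have "x \<noteq> 0" by auto
      then show ?case using elim J_radial[of x] by simp
    qed
  qed measurable
  then show ?thesis
    using AE_sphere_measure_in_sphere
  proof eventually_elim
    case (elim \<theta>)
    let ?H = "normal_hyperplane \<theta>"
    obtain f where f: "continuous_on UNIV f" "\<forall>x. 0 \<le> f x"
      "pushforward_proj \<theta> M = density (lborel_subspace ?H) (\<lambda>x. ennreal (f x))"
      using projection_continuous_density[OF assms(2,3), of \<theta> k] elim unfolding J_def by blast
    have "f \<in> borel_measurable borel" using f(1) by (rule borel_measurable_continuous_onI)
    then have "(\<lambda>x. ennreal (f x)) \<in> borel_measurable (lborel_subspace ?H)"
      by (subst measurable_cong_sets[OF sets_lborel_subspace refl]) (intro measurable_restrict_space1, measurable)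
    then have "absolutely_continuous (lborel_subspace ?H) (pushforward_proj \<theta> M)"
      unfolding f(3) by (rule absolutely_continuousI_density)
    then show ?case using f continuous_on_subset[OF f(1)] by blast
  qed
qed

end
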